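(* Let $d_0,d\ge 1$, let $D\subset\mathbb{C}^d$ be a domain, let $\varphi$ be a positive function on $D$ such that $-\log\varphi$ is a $C^\infty$ strictly plurisubharmonic exhaustion function on $D$, and suppose that $$\Omega=\{(z_0,z)\in\mathbb{C}^{d_0}\times D:\ \|z_0\|^2<\varphi(z)\}$$ is a bounded pseudoconvex domain. Let $g^D$ and $g^\Omega$ be the Kähler metrics on $D$ and $\Omega$ whose Kähler potentials are $-\log\varphi(z)$ and $-\log(\varphi(z)-\|z_0\|^2)$ respectively. If $g^D$ is a Kähler-Einstein metric, then the following conditions are equivalent: (i) $g^\Omega$ is a Kähler-Einstein metric with Ricci curvature $-(d_0+d+1)$; (ii) $g^\Omega$ is an extremal metric; (iii) the scalar curvature of $g^\Omega$ is constant; (iv) the Ricci curvature of $g^D$ equals $-(d+1)$.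
   Context: Conventions. A Kähler metric $g$ with Kähler potential $\Phi$ has components $g_{\alpha\overline\beta}=\partial^2\Phi/\partial z_\alpha\partial\overline z_\beta$ (Kähler form $\frac{\sqrt{-1}}{2}\partial\overline\partial\Phi$). Its Ricci tensor is $\mathrm{Ric}_{\alpha\overline\beta}=-\partial^2\log\det(g)/\partial z_\alpha\partial\overline z_\beta$. The metric is Kähler-Einstein with Ricci curvature $c\in\mathbb{R}$ if $\mathrm{Ric}=c\,g$. Writing $(g^{\alpha\overline\beta})$ for the inverse matrix of $(g_{\alpha\overline\beta})$, the scalar curvature is $s_g=\sum_{\alpha,\beta}g^{\beta\overline\alpha}\mathrm{Ric}_{\alpha\overline\beta}$. On an $n$-dimensional complex manifold the metric $g$ is called extremal if, in local coordinates, $\frac{\partial}{\partial\overline z_\eta}\sum_{\beta=1}^n g^{\beta\overline\alpha}\frac{\partial s_g}{\partial\overline z_\beta}=0$ for all $\alpha,\eta=1,\dots,n$. Here $\|\cdot\|$ is the standard Hermitian norm. *)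

theory Defs
  imports "HOL-Analysis.Analysis"
begin

fun Ck_on :: "nat \<Rightarrow> 'a::real_normed_vector set \<Rightarrow> ('a \<Rightarrow> 'b::real_normed_vector) \<Rightarrow> bool" where
  "Ck_on 0 S f \<longleftrightarrow> continuous_on S f"
| "Ck_on (Suc k) S f \<longleftrightarrow> (\<forall>x\<in>S. f differentiable (at x)) \<and>
     (\<forall>v. Ck_on k S (\<lambda>x. frechet_derivative f (at x) v))"

text \<open>Intended for open \<open>S\<close>: the derivatives are taken at full neighbourhoods.\<close>

definition smooth_on :: "'a::real_normed_vector set \<Rightarrow> ('a \<Rightarrow> 'b::real_normed_vector) \<Rightarrow> bool" where
  "smooth_on S f \<longleftrightarrow> (\<forall>k. Ck_on k S f)"

text \<open>The Wirtinger derivatives, with \<open>z\<^sub>k = x\<^sub>k + \<i> y\<^sub>k\<close>; \<open>axis k 1\<close> and \<open>axis k \<i>\<close> are the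
  real coordinate directions of \<open>x\<^sub>k\<close> and \<open>y\<^sub>k\<close>.\<close>

definition dz :: "'n::finite \<Rightarrow> (complex^'n \<Rightarrow> complex) \<Rightarrow> complex^'n \<Rightarrow> complex" where
  "dz k f z = (frechet_derivative f (at z) (axis k 1)
                 - \<i> * frechet_derivative f (at z) (axis k \<i>)) / 2"

definition dzbar :: "'n::finite \<Rightarrow> (complex^'n \<Rightarrow> complex) \<Rightarrow> complex^'n \<Rightarrow> complex" where
  "dzbar k f z = (frechet_derivative f (at z) (axis k 1)
                    + \<i> * frechet_derivative f (at z) (axis k \<i>)) / 2"

definition complex_hessian :: "(complex^'n::finite \<Rightarrow> complex) \<Rightarrow> complex^'n \<Rightarrow> complex^'n^'n" where
  "complex_hessian f z = (\<chi> \<alpha> \<beta>. dz \<alpha> (dzbar \<beta> f) z)"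

text \<open>Strict plurisubharmonicity of a function of class \<open>C\<^sup>2\<close>: its Levi form, which is then
  real valued, is positive definite at every point.\<close>

definition strictly_psh_on :: "(complex^'n::finite) set \<Rightarrow> (complex^'n \<Rightarrow> real) \<Rightarrow> bool" where
  "strictly_psh_on S u \<longleftrightarrow> (\<forall>z\<in>S. \<forall>w. w \<noteq> 0 \<longrightarrow>
     0 < Re (\<Sum>\<alpha>\<in>UNIV. \<Sum>\<beta>\<in>UNIV.
        complex_hessian (\<lambda>x. complex_of_real (u x)) z $ \<alpha> $ \<beta> * w $ \<alpha> * cnj (w $ \<beta>)))"

text \<open>Every sublevel set is relatively compact in \<open>S\<close>.\<close>

definition exhaustion_on :: "'a::metric_space set \<Rightarrow> ('a \<Rightarrow> real) \<Rightarrow> bool" where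
  "exhaustion_on S u \<longleftrightarrow> (\<forall>c. compact (closure {x\<in>S. u x < c}) \<and> closure {x\<in>S. u x < c} \<subseteq> S)"

text \<open>Continuous plurisubharmonic functions need not be differentiable; they are characterised by
  the sub-mean value property on all closed discs in complex lines.\<close>

definition continuous_psh_on :: "(complex^'n::finite) set \<Rightarrow> (complex^'n \<Rightarrow> real) \<Rightarrow> bool" where
  "continuous_psh_on S u \<longleftrightarrow> continuous_on S u \<and>
     (\<forall>a\<in>S. \<forall>w. (\<forall>\<zeta>. norm \<zeta> \<le> 1 \<longrightarrow> a + \<zeta> *s w \<in> S) \<longrightarrow>
        u a \<le> integral {0..2*pi} (\<lambda>\<theta>. u (a + cis \<theta> *s w)) / (2*pi))"

definition pseudoconvex :: "(complex^'n::finite) set \<Rightarrow> bool" where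
  "pseudoconvex S \<longleftrightarrow> open S \<and> (\<exists>u. continuous_psh_on S u \<and> exhaustion_on S u)"

text \<open>A metric is given by its matrix of components: \<open>g z $ \<alpha> $ \<beta>\<close> is the component of \<open>g\<close> with
  holomorphic index \<open>\<alpha>\<close> and antiholomorphic index \<open>\<beta>\<close> at the point \<open>z\<close>.\<close>

definition kahler_metric :: "(complex^'n::finite \<Rightarrow> real) \<Rightarrow> complex^'n \<Rightarrow> complex^'n^'n" where
  "kahler_metric \<Phi> = complex_hessian (\<lambda>z. complex_of_real (\<Phi> z))"

text \<open>Where \<open>g\<close> is positive definite its determinant is a positive real number, so that the
  principal branch of the logarithm is the real one.\<close>

definition ricci :: "(complex^'n::finite \<Rightarrow> complex^'n^'n) \<Rightarrow> complex^'n \<Rightarrow> complex^'n^'n" where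
  "ricci g z = - complex_hessian (\<lambda>x. Ln (det (g x))) z"

definition einstein_on ::
  "(complex^'n::finite) set \<Rightarrow> (complex^'n \<Rightarrow> complex^'n^'n) \<Rightarrow> real \<Rightarrow> bool" where
  "einstein_on S g c \<longleftrightarrow> (\<forall>z\<in>S. ricci g z = c *\<^sub>R g z)"

definition scalar_curvature ::
  "(complex^'n::finite \<Rightarrow> complex^'n^'n) \<Rightarrow> complex^'n \<Rightarrow> complex" where
  "scalar_curvature g z =
     (\<Sum>\<alpha>\<in>UNIV. \<Sum>\<beta>\<in>UNIV. matrix_inv (g z) $ \<beta> $ \<alpha> * ricci g z $ \<alpha> $ \<beta>)"

definition extremal_on ::
  "(complex^'n::finite) set \<Rightarrow> (complex^'n \<Rightarrow> complex^'n^'n) \<Rightarrow> bool" where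
  "extremal_on S g \<longleftrightarrow> (\<forall>z\<in>S. \<forall>\<alpha> \<eta>.
     dzbar \<eta> (\<lambda>x. \<Sum>\<beta>\<in>UNIV. matrix_inv (g x) $ \<beta> $ \<alpha> * dzbar \<beta> (scalar_curvature g) x) z = 0)"

text \<open>Points of the product of two complex coordinate spaces are encoded as vectors indexed by
  the sum of the two index types.\<close>

definition fst_block :: "complex^('m::finite + 'n::finite) \<Rightarrow> complex^'m" where
  "fst_block p = (\<chi> i. p $ Inl i)"

definition snd_block :: "complex^('m::finite + 'n::finite) \<Rightarrow> complex^'n" where
  "snd_block p = (\<chi> j. p $ Inr j)"

definition hartogs_domain ::
  "(complex^'n::finite) set \<Rightarrow> (complex^'n \<Rightarrow> real) \<Rightarrow> (complex^('m::finite + 'n)) set" where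
  "hartogs_domain D \<phi> = {p. snd_block p \<in> D \<and> (norm (fst_block p))\<^sup>2 < \<phi> (snd_block p)}"

end

theory Submission imports Defs begin

text \<open>Put \<open>u = - log \<phi>\<close> and \<open>t = \<parallel>z\<^sub>0\<parallel>\<^sup>2 / \<phi> = \<parallel>z\<^sub>0\<parallel>\<^sup>2 e\<^sup>u\<close>, so that the potential on \<open>\<Omega>\<close> is \<open>u - log (1 - t)\<close>.
  The function \<open>t\<close> is annihilated by the horizontal lifts \<open>\<partial>\<^sub>a - u\<^sub>a (\<Sum> z\<^sub>i \<partial>\<^sub>i)\<close> of the coordinate fields of
  \<open>D\<close>. In the frame formed by these lifts and the vertical fields \<open>\<partial>\<^sub>i\<close> the metric of \<open>\<Omega>\<close> is block
  diagonal: its horizontal block is \<open>g\<^sup>D / (1 - t)\<close>, and its vertical block is a multiple of the identity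
  plus a matrix of rank one. Three consequences are drawn from this. Let \<open>N = d\<^sub>0 + d\<close>.

  First, the determinant is \<open>\<phi>\<close> to the power \<open>- d\<^sub>0\<close>, times \<open>1 - t\<close> to the power \<open>- (N + 1)\<close>, times
  \<open>det g\<^sup>D\<close> (\<open>det_gOmega\<close>). Taking \<open>- \<partial>\<close> \<open>\<partial>\<close>-bar of the logarithm gives the Ricci tensor
  \<open>- (N + 1) g + (d + 1) \<pi>\<^sup>* g\<^sup>D + \<pi>\<^sup>* Ric\<close>, where \<open>\<pi>\<close> is the projection to \<open>D\<close> and \<open>Ric\<close> the Ricci
  tensor of \<open>D\<close>. If \<open>g\<^sup>D\<close> is Einstein with constant \<open>c\<close>, this is \<open>- (N + 1) g + K \<pi>\<^sup>* g\<^sup>D\<close> with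
  \<open>K = c + d + 1\<close> (\<open>ricci_gOmega\<close>).

  Secondly, the trace of \<open>\<pi>\<^sup>* g\<^sup>D\<close> with respect to \<open>g\<close> is \<open>d (1 - t)\<close>, so that the scalar curvature is
  \<open>- N (N + 1) + K d (1 - t)\<close> (\<open>scalar_curvature_gOmega\<close>).

  Thirdly, the gradient of type (1,0) of the scalar curvature is the vertical field
  \<open>- K d (1 - t)\<^sup>2 (\<Sum> z\<^sub>i \<partial>\<^sub>i)\<close> (\<open>gradient_scalar_curvature_gOmega\<close>). It is not holomorphic at points with
  \<open>z\<^sub>0 \<noteq> 0\<close>, unless \<open>K = 0\<close>.

  Hence each of the four conditions is equivalent to \<open>K = 0\<close>. The logarithm of \<open>det g\<^sup>D\<close> can be
  differentiated because the determinant is a positive real number; this rests on the symmetry of second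
  derivatives, which makes the complex Hessian Hermitian.\<close>

section \<open>Continuously differentiable functions\<close>

lemma Ck_on_cong:
  assumes "open S" "\<And>x. x \<in> S \<Longrightarrow> f x = g x" "Ck_on k S f"
  shows "Ck_on k S g"
  using assms(2,3)
proof (induction k arbitrary: f g)
  case 0
  then show ?case using continuous_on_cong[of S S f g] by simp
next
  case (Suc k)
  have d: "f differentiable (at x)" if "x \<in> S" for x using Suc.prems that by simp
  have e: "frechet_derivative f (at x) = frechet_derivative g (at x)" if "x \<in> S" for x
    using frechet_derivative_transform_within_open[OF d[OF that] assms(1) that] Suc.prems(1) by blast
  have "g differentiable (at x)" if "x \<in> S" for x
    using d[OF that] Suc.prems(1) assms(1) that
    unfolding differentiable_def by (meson has_derivative_transform_within_open)
  moreover have "Ck_on k S (\<lambda>x. frechet_derivative g (at x) v)" for v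
    using Suc.IH[of "\<lambda>x. frechet_derivative f (at x) v" "\<lambda>x. frechet_derivative g (at x) v"] e Suc.prems(2) by simp
  ultimately show ?case by simp
qed

lemma Ck_on_Suc_imp: "Ck_on (Suc k) S f \<Longrightarrow> Ck_on k S f"
proof (induction k arbitrary: f)
  case 0
  then show ?case
    by (auto intro!: continuous_at_imp_continuous_on differentiable_imp_continuous_within)
next
  case (Suc k)
  then show ?case by (metis Ck_on.simps(2))
qed

text \<open>The step of every induction below: it exchanges the Frechet derivative chosen by the definition for
  the expression that a differentiation rule produces. The two agree at the points of the open set \<open>S\<close>, and
  \<open>Ck_on_cong\<close> transports regularity from one to the other.\<close>

lemma Ck_on_SucI:
  assumes "open S" "\<And>x. x \<in> S \<Longrightarrow> (f has_derivative f' x) (at x)" "\<And>v. Ck_on k S (\<lambda>x. f' x v)"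
  shows "Ck_on (Suc k) S f"
proof -
  have "frechet_derivative f (at x) = f' x" if "x \<in> S" for x
    using frechet_derivative_at[OF assms(2)[OF that]] by simp
  then have "Ck_on k S (\<lambda>x. frechet_derivative f (at x) v)" for v
    using Ck_on_cong[OF assms(1) _ assms(3)[of v]] by simp
  then show ?thesis using assms(2) by (auto simp: differentiable_def)
qed

lemma Ck_on_has_derivative:
  "Ck_on (Suc k) S f \<Longrightarrow> x \<in> S \<Longrightarrow> (f has_derivative frechet_derivative f (at x)) (at x)"
  by (auto simp: frechet_derivative_works)

lemma Ck_on_const: "open S \<Longrightarrow> Ck_on k S (\<lambda>x. c)"
proof (induction k arbitrary: c)
  case (Suc k) show ?case by (rule Ck_on_SucI[OF Suc.prems has_derivative_const]) (use Suc in auto)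
qed auto

lemma Ck_on_bounded_linear:
  "bounded_linear h \<Longrightarrow> open S \<Longrightarrow> Ck_on k S f \<Longrightarrow> Ck_on k S (\<lambda>x. h (f x))"
proof (induction k arbitrary: f)
  case 0 then show ?case by (simp add: bounded_linear.continuous_on)
next
  case (Suc k)
  show ?case
    by (rule Ck_on_SucI[OF Suc.prems(2)], rule bounded_linear.has_derivative[OF Suc.prems(1)],
        rule Ck_on_has_derivative[OF Suc.prems(3)]) (use Suc in auto)
qed

lemma Ck_on_linear_comp:
  "bounded_linear h \<Longrightarrow> open T \<Longrightarrow> open S \<Longrightarrow> h ` T \<subseteq> S \<Longrightarrow> Ck_on k S f \<Longrightarrow> Ck_on k T (\<lambda>x. f (h x))"
proof (induction k arbitrary: f)
  case 0 then show ?case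
    using continuous_on_compose2[OF _ linear_continuous_on] by auto
next
  case (Suc k)
  have lin: "(h has_derivative h) (at x)" for x
    by (rule bounded_linear_imp_has_derivative[OF Suc.prems(1)])
  show ?case
  proof (rule Ck_on_SucI[OF Suc.prems(2)])
    fix x assume "x \<in> T"
    then have "h x \<in> S" using Suc.prems by auto
    from has_derivative_compose[OF lin Ck_on_has_derivative[OF Suc.prems(5) this]]
    show "((\<lambda>x. f (h x)) has_derivative (\<lambda>v. frechet_derivative f (at (h x)) (h v))) (at x)" .
  next
    fix v show "Ck_on k T (\<lambda>x. frechet_derivative f (at (h x)) (h v))"
      using Suc.IH[OF Suc.prems(1-4), of "\<lambda>x. frechet_derivative f (at x) (h v)"] Suc.prems(5) by simp
  qed
qed

lemma Ck_on_add: "open S \<Longrightarrow> Ck_on k S f \<Longrightarrow> Ck_on k S g \<Longrightarrow> Ck_on k S (\<lambda>x. f x + g x)"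
proof (induction k arbitrary: f g)
  case 0 then show ?case by (simp add: continuous_on_add)
next
  case (Suc k)
  show ?case
    by (rule Ck_on_SucI[OF Suc.prems(1)],
        rule has_derivative_add[OF Ck_on_has_derivative[OF Suc.prems(2)] Ck_on_has_derivative[OF Suc.prems(3)]])
       (use Suc in auto)
qed

lemma Ck_on_mult:
  fixes f g :: "'a::real_normed_vector \<Rightarrow> 'b::real_normed_algebra"
  shows "open S \<Longrightarrow> Ck_on k S f \<Longrightarrow> Ck_on k S g \<Longrightarrow> Ck_on k S (\<lambda>x. f x * g x)"
proof (induction k arbitrary: f g)
  case 0 then show ?case by (simp add: continuous_on_mult)
next
  case (Suc k)
  note lower = Suc.prems(2,3)[THEN Ck_on_Suc_imp]
  show ?case
    by (rule Ck_on_SucI[OF Suc.prems(1)],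
        rule has_derivative_mult[OF Ck_on_has_derivative[OF Suc.prems(2)] Ck_on_has_derivative[OF Suc.prems(3)]])
       (use Suc lower in \<open>auto intro!: Ck_on_add\<close>)
qed

lemma Ck_on_inverse:
  fixes f :: "'a::real_normed_vector \<Rightarrow> 'b::real_normed_field"
  shows "open S \<Longrightarrow> (\<And>x. x \<in> S \<Longrightarrow> f x \<noteq> 0) \<Longrightarrow> Ck_on k S f \<Longrightarrow> Ck_on k S (\<lambda>x. inverse (f x))"
proof (induction k)
  case 0 then show ?case by (simp add: continuous_on_inverse)
next
  case (Suc k)
  note lower = Suc.prems(3)[THEN Ck_on_Suc_imp]
  have IH: "Ck_on k S (\<lambda>x. inverse (f x))" using Suc lower by blast
  have m: "Ck_on k S (\<lambda>x. - u x)" if "Ck_on k S u" for u :: "'a \<Rightarrow> 'b"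
    by (rule Ck_on_bounded_linear[OF bounded_linear_minus[OF bounded_linear_ident] Suc.prems(1) that])
  show ?case
    by (rule Ck_on_SucI[OF Suc.prems(1)],
        rule Deriv.has_derivative_inverse[OF Suc.prems(2) Ck_on_has_derivative[OF Suc.prems(3)]])
       (use Suc.prems IH in \<open>auto intro!: m Ck_on_mult\<close>)
qed

text \<open>The derivative of \<open>h \<circ> f\<close> is \<open>(h' \<circ> f) f'\<close>. Regularity of \<open>h' \<circ> f\<close> is a hypothesis here, so
  that the lemma serves both for \<open>exp\<close>, where \<open>h' \<circ> f\<close> is the composition under study one order lower, and
  for \<open>Ln\<close>, where it is a reciprocal.\<close>

lemma Ck_on_field_comp:
  fixes f :: "'a::real_normed_vector \<Rightarrow> 'b::real_normed_field"
  assumes S: "open S" and f: "Ck_on (Suc k) S f"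
    and h: "\<And>x. x \<in> S \<Longrightarrow> (h has_field_derivative h' (f x)) (at (f x))"
    and h': "Ck_on k S (\<lambda>x. h' (f x))"
  shows "Ck_on (Suc k) S (\<lambda>x. h (f x))"
proof (rule Ck_on_SucI[OF S])
  fix x assume "x \<in> S"
  from has_derivative_compose[OF Ck_on_has_derivative[OF f this] h[OF this, unfolded has_field_derivative_def]]
  show "((\<lambda>x. h (f x)) has_derivative (\<lambda>v. h' (f x) * frechet_derivative f (at x) v)) (at x)" .
next
  fix v show "Ck_on k S (\<lambda>x. h' (f x) * frechet_derivative f (at x) v)"
    using f h' by (intro Ck_on_mult[OF S]) auto
qed

lemma Ck_on_exp: "open S \<Longrightarrow> Ck_on k S f \<Longrightarrow> Ck_on k S (\<lambda>x. exp (f x :: complex))"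
proof (induction k)
  case 0 then show ?case by (simp add: continuous_on_exp)
next
  case (Suc k)
  show ?case
    by (rule Ck_on_field_comp[OF Suc.prems, of exp exp]) (use Suc Ck_on_Suc_imp in \<open>auto intro: DERIV_exp\<close>)
qed

lemma smooth_on_differentiable: "smooth_on S f \<Longrightarrow> x \<in> S \<Longrightarrow> f differentiable (at x)"
  using Ck_on.simps(2) unfolding smooth_on_def by blast

lemma smooth_on_frechet_derivative: "smooth_on S f \<Longrightarrow> smooth_on S (\<lambda>x. frechet_derivative f (at x) v)"
  using Ck_on.simps(2) unfolding smooth_on_def by blast

lemma smooth_on_cong: "open S \<Longrightarrow> (\<And>x. x \<in> S \<Longrightarrow> f x = g x) \<Longrightarrow> smooth_on S f \<Longrightarrow> smooth_on S g"
  using Ck_on_cong unfolding smooth_on_def by blast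

lemma smooth_on_const: "open S \<Longrightarrow> smooth_on S (\<lambda>x. c)"
  by (simp add: smooth_on_def Ck_on_const)

lemma smooth_on_bounded_linear: "bounded_linear h \<Longrightarrow> open S \<Longrightarrow> smooth_on S f \<Longrightarrow> smooth_on S (\<lambda>x. h (f x))"
  by (simp add: smooth_on_def Ck_on_bounded_linear)

lemma smooth_on_linear_comp:
  "bounded_linear h \<Longrightarrow> open T \<Longrightarrow> open S \<Longrightarrow> h ` T \<subseteq> S \<Longrightarrow> smooth_on S f \<Longrightarrow> smooth_on T (\<lambda>x. f (h x))"
  by (simp add: smooth_on_def Ck_on_linear_comp)

lemma smooth_on_linear: "bounded_linear h \<Longrightarrow> open S \<Longrightarrow> smooth_on S h"
proof -
  assume h: "bounded_linear h" and S: "open S"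
  have "Ck_on k S h" for k
  proof (cases k)
    case 0 then show ?thesis by (simp add: linear_continuous_on[OF h])
  next
    case (Suc j)
    show ?thesis unfolding Suc
      by (rule Ck_on_SucI[OF S bounded_linear_imp_has_derivative[OF h] Ck_on_const[OF S]])
  qed
  then show ?thesis by (simp add: smooth_on_def)
qed

lemma smooth_on_add: "open S \<Longrightarrow> smooth_on S f \<Longrightarrow> smooth_on S g \<Longrightarrow> smooth_on S (\<lambda>x. f x + g x)"
  by (simp add: smooth_on_def Ck_on_add)

lemma smooth_on_mult:
  fixes f g :: "'a::real_normed_vector \<Rightarrow> 'b::real_normed_algebra"
  shows "open S \<Longrightarrow> smooth_on S f \<Longrightarrow> smooth_on S g \<Longrightarrow> smooth_on S (\<lambda>x. f x * g x)"
  by (simp add: smooth_on_def Ck_on_mult)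

lemma smooth_on_diff: "open S \<Longrightarrow> smooth_on S f \<Longrightarrow> smooth_on S g \<Longrightarrow> smooth_on S (\<lambda>x. f x - g x)"
  using smooth_on_add[of S f "\<lambda>x. - g x"]
    smooth_on_bounded_linear[OF bounded_linear_minus[OF bounded_linear_ident], of S g] by simp

lemma smooth_on_inverse:
  fixes f :: "'a::real_normed_vector \<Rightarrow> 'b::real_normed_field"
  shows "open S \<Longrightarrow> (\<And>x. x \<in> S \<Longrightarrow> f x \<noteq> 0) \<Longrightarrow> smooth_on S f \<Longrightarrow> smooth_on S (\<lambda>x. inverse (f x))"
  by (simp add: smooth_on_def Ck_on_inverse)

lemma smooth_on_exp: "open S \<Longrightarrow> smooth_on S f \<Longrightarrow> smooth_on S (\<lambda>x. exp (f x :: complex))"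
  by (simp add: smooth_on_def Ck_on_exp)

lemma smooth_on_Ln:
  assumes "open S" "\<And>x. x \<in> S \<Longrightarrow> f x \<notin> \<real>\<^sub>\<le>\<^sub>0" "smooth_on S f"
  shows "smooth_on S (\<lambda>x. Ln (f x))"
proof -
  have nz: "f x \<noteq> 0" if "x \<in> S" for x using assms(2)[OF that] by auto
  have "Ck_on (Suc k) S (\<lambda>x. Ln (f x))" for k
  proof (rule Ck_on_field_comp[OF assms(1), where h = Ln and h' = inverse])
    show "Ck_on (Suc k) S f" using assms(3) unfolding smooth_on_def by blast
    show "(Ln has_field_derivative inverse (f x)) (at (f x))" if "x \<in> S" for x
      using has_field_derivative_Ln[OF assms(2)[OF that]] .
    show "Ck_on k S (\<lambda>x. inverse (f x))"
      using smooth_on_inverse[OF assms(1) nz assms(3)] unfolding smooth_on_def by blast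
  qed
  then show ?thesis unfolding smooth_on_def by (metis Ck_on_Suc_imp)
qed

lemma smooth_on_sum: "open S \<Longrightarrow> (\<And>i. i \<in> I \<Longrightarrow> smooth_on S (f i)) \<Longrightarrow> smooth_on S (\<lambda>x. \<Sum>i\<in>I. f i x)"
  by (induction I rule: infinite_finite_induct) (auto intro: smooth_on_const smooth_on_add)

lemma smooth_on_prod:
  fixes f :: "'i \<Rightarrow> 'a::real_normed_vector \<Rightarrow> 'b::real_normed_field"
  shows "open S \<Longrightarrow> (\<And>i. i \<in> I \<Longrightarrow> smooth_on S (f i)) \<Longrightarrow> smooth_on S (\<lambda>x. \<Prod>i\<in>I. f i x)"
  by (induction I rule: infinite_finite_induct) (auto intro: smooth_on_const smooth_on_mult)

lemma smooth_on_det: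
  fixes g :: "'a::real_normed_vector \<Rightarrow> complex^'n^'n"
  assumes "open S" "\<And>i j. smooth_on S (\<lambda>x. g x $ i $ j)"
  shows "smooth_on S (\<lambda>x. det (g x))"
  unfolding det_def
  by (intro smooth_on_sum smooth_on_mult smooth_on_prod smooth_on_const assms)

lemma smooth_on_dz: "open S \<Longrightarrow> smooth_on S f \<Longrightarrow> smooth_on S (dz k f)"
  unfolding dz_def divide_inverse
  by (intro smooth_on_mult smooth_on_diff smooth_on_const smooth_on_frechet_derivative)

lemma smooth_on_dzbar: "open S \<Longrightarrow> smooth_on S f \<Longrightarrow> smooth_on S (dzbar k f)"
  unfolding dzbar_def divide_inverse
  by (intro smooth_on_mult smooth_on_add smooth_on_const smooth_on_frechet_derivative)

section \<open>Rules for Wirtinger derivatives\<close>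

lemma dz_eqI:
  "(f has_derivative f') (at z) \<Longrightarrow> dz k f z = (f' (axis k 1) - \<i> * f' (axis k \<i>)) / 2"
  by (simp add: dz_def frechet_derivative_at[symmetric])

lemma dzbar_eqI:
  "(f has_derivative f') (at z) \<Longrightarrow> dzbar k f z = (f' (axis k 1) + \<i> * f' (axis k \<i>)) / 2"
  by (simp add: dzbar_def frechet_derivative_at[symmetric])

lemma dz_cong: 
  assumes "open S" "z \<in> S" "\<And>x. x \<in> S \<Longrightarrow> f x = g x" "f differentiable (at z)"
  shows "dz k f z = dz k g z"
  using frechet_derivative_transform_within_open[OF assms(4,1,2,3)] by (simp add: dz_def)

lemma dzbar_cong: 
  assumes "open S" "z \<in> S" "\<And>x. x \<in> S \<Longrightarrow> f x = g x" "f differentiable (at z)"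
  shows "dzbar k f z = dzbar k g z"
  using frechet_derivative_transform_within_open[OF assms(4,1,2,3)] by (simp add: dzbar_def)

lemma dz_const: "dz k (\<lambda>x. c) z = 0" and dzbar_const: "dzbar k (\<lambda>x. c) z = 0"
  by (simp_all add: dz_def dzbar_def)

lemma dz_add:
    "f differentiable (at z) \<Longrightarrow> g differentiable (at z) \<Longrightarrow> dz k (\<lambda>x. f x + g x) z = dz k f z + dz k g z"
  and dzbar_add:
    "f differentiable (at z) \<Longrightarrow> g differentiable (at z) \<Longrightarrow> dzbar k (\<lambda>x. f x + g x) z = dzbar k f z + dzbar k g z"
proof -
  assume "f differentiable (at z)" "g differentiable (at z)"
  then have "((\<lambda>x. f x + g x) has_derivative (\<lambda>v. frechet_derivative f (at z) v + frechet_derivative g (at z) v)) (at z)"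
    unfolding frechet_derivative_works by (rule has_derivative_add)
  from dz_eqI[OF this] dzbar_eqI[OF this]
  show "dz k (\<lambda>x. f x + g x) z = dz k f z + dz k g z"
    "dzbar k (\<lambda>x. f x + g x) z = dzbar k f z + dzbar k g z"
    by (simp_all add: dz_def dzbar_def algebra_simps add_divide_distrib diff_divide_distrib)
qed

lemma dz_mult:
    "f differentiable (at z) \<Longrightarrow> g differentiable (at z) \<Longrightarrow> dz k (\<lambda>x. f x * g x) z = f z * dz k g z + dz k f z * g z"
  and dzbar_mult:
    "f differentiable (at z) \<Longrightarrow> g differentiable (at z) \<Longrightarrow> dzbar k (\<lambda>x. f x * g x) z = f z * dzbar k g z + dzbar k f z * g z"
proof -
  assume "f differentiable (at z)" "g differentiable (at z)"
  then have "((\<lambda>x. f x * g x) has_derivative (\<lambda>v. f z * frechet_derivative g (at z) v + frechet_derivative f (at z) v * g z)) (at z)"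
    unfolding frechet_derivative_works by (rule has_derivative_mult)
  from dz_eqI[OF this] dzbar_eqI[OF this]
  show "dz k (\<lambda>x. f x * g x) z = f z * dz k g z + dz k f z * g z"
    "dzbar k (\<lambda>x. f x * g x) z = f z * dzbar k g z + dzbar k f z * g z"
    by (simp_all add: dz_def dzbar_def algebra_simps add_divide_distrib diff_divide_distrib)
qed

lemma dz_diff:
    "f differentiable (at z) \<Longrightarrow> g differentiable (at z) \<Longrightarrow> dz k (\<lambda>x. f x - g x) z = dz k f z - dz k g z"
  and dzbar_diff:
    "f differentiable (at z) \<Longrightarrow> g differentiable (at z) \<Longrightarrow> dzbar k (\<lambda>x. f x - g x) z = dzbar k f z - dzbar k g z"
proof -
  assume "f differentiable (at z)" "g differentiable (at z)"
  then have "((\<lambda>x. f x - g x) has_derivative (\<lambda>v. frechet_derivative f (at z) v - frechet_derivative g (at z) v)) (at z)"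
    unfolding frechet_derivative_works by (rule has_derivative_diff)
  from dz_eqI[OF this] dzbar_eqI[OF this]
  show "dz k (\<lambda>x. f x - g x) z = dz k f z - dz k g z"
    "dzbar k (\<lambda>x. f x - g x) z = dzbar k f z - dzbar k g z"
    by (simp_all add: dz_def dzbar_def algebra_simps add_divide_distrib diff_divide_distrib)
qed

text \<open>The derivative of \<open>h\<close> is complex linear, so it commutes with both Wirtinger combinations of real partial
  derivatives.\<close>

lemma dz_holomorphic_comp:
  assumes "(h has_field_derivative h') (at (f z))" "f differentiable (at z)"
  shows "dz k (\<lambda>x. h (f x)) z = h' * dz k f z" "dzbar k (\<lambda>x. h (f x)) z = h' * dzbar k f z"
proof -
  have "((\<lambda>x. h (f x)) has_derivative (\<lambda>v. h' * frechet_derivative f (at z) v)) (at z)"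
    using has_derivative_compose[of f "frechet_derivative f (at z)" z UNIV h "(*) h'"] assms
    by (simp add: frechet_derivative_works has_field_derivative_def)
  from dz_eqI[OF this] dzbar_eqI[OF this]
  show "dz k (\<lambda>x. h (f x)) z = h' * dz k f z" "dzbar k (\<lambda>x. h (f x)) z = h' * dzbar k f z"
    by (simp_all add: dz_def dzbar_def field_simps)
qed

lemma dz_sum:
    "(\<And>i. i \<in> I \<Longrightarrow> f i differentiable (at z)) \<Longrightarrow> dz k (\<lambda>x. \<Sum>i\<in>I. f i x) z = (\<Sum>i\<in>I. dz k (f i) z)"
  and dzbar_sum:
    "(\<And>i. i \<in> I \<Longrightarrow> f i differentiable (at z)) \<Longrightarrow> dzbar k (\<lambda>x. \<Sum>i\<in>I. f i x) z = (\<Sum>i\<in>I. dzbar k (f i) z)"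
  by (induction I rule: infinite_finite_induct)
     (simp_all add: dz_const dzbar_const dz_add dzbar_add differentiable_sum)

lemma
  fixes z :: "complex^'n"
  shows dz_coord: "dz k (\<lambda>x. x $ i) z = (if k = i then 1 else 0)"
  and dzbar_coord: "dzbar k (\<lambda>x. x $ i) z = 0"
proof -
  have "((\<lambda>x::complex^'n. x $ i) has_derivative (\<lambda>x. x $ i)) (at z)"
    by (rule bounded_linear_imp_has_derivative) (rule bounded_linear_vec_nth)
  from dz_eqI[OF this, of k] dzbar_eqI[OF this, of k]
  show "dz k (\<lambda>x. x $ i) z = (if k = i then 1 else 0)" "dzbar k (\<lambda>x. x $ i) z = 0"
    by (cases "k = i"; simp add: axis_def)+
qed

lemma bounded_linear_cnj_coord: "bounded_linear (\<lambda>x::complex^'n. cnj (x $ i))"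
  using bounded_linear_compose[OF bounded_linear_cnj bounded_linear_vec_nth] .

lemma
  fixes z :: "complex^'n"
  shows dz_cnj_coord: "dz k (\<lambda>x. cnj (x $ i)) z = 0"
  and dzbar_cnj_coord: "dzbar k (\<lambda>x. cnj (x $ i)) z = (if k = i then 1 else 0)"
proof -
  have "((\<lambda>x::complex^'n. cnj (x $ i)) has_derivative (\<lambda>x. cnj (x $ i))) (at z)"
    by (rule bounded_linear_imp_has_derivative) (rule bounded_linear_cnj_coord)
  from dz_eqI[OF this, of k] dzbar_eqI[OF this, of k]
  show "dz k (\<lambda>x. cnj (x $ i)) z = 0" "dzbar k (\<lambda>x. cnj (x $ i)) z = (if k = i then 1 else 0)"
    by (cases "k = i"; simp add: axis_def)+
qed

section \<open>The complex Hessian\<close>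

lemma complex_hessian_cong: 
  assumes S: "open S" "z \<in> S" and eq: "\<And>x. x \<in> S \<Longrightarrow> f x = g x" and f: "smooth_on S f"
  shows "complex_hessian f z = complex_hessian g z"
proof -
  have "dz \<alpha> (dzbar \<beta> f) z = dz \<alpha> (dzbar \<beta> g) z" for \<alpha> \<beta>
    by (intro dz_cong[OF S] dzbar_cong[OF S(1)] eq smooth_on_differentiable[OF f]
        smooth_on_differentiable[OF smooth_on_dzbar[OF S(1) f]] S)
  then show ?thesis by (simp add: complex_hessian_def)
qed

lemma complex_hessian_add: 
  assumes S: "open S" "z \<in> S" and f: "smooth_on S f" and g: "smooth_on S g"
  shows "complex_hessian (\<lambda>x. f x + g x) z = complex_hessian f z + complex_hessian g z"
proof -
  note d = smooth_on_differentiable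
  have "dz \<alpha> (dzbar \<beta> (\<lambda>x. f x + g x)) z = dz \<alpha> (\<lambda>x. dzbar \<beta> f x + dzbar \<beta> g x) z" for \<alpha> \<beta>
    by (intro dz_cong[OF S] dzbar_add d[OF f] d[OF g] S
        d[OF smooth_on_dzbar[OF S(1) smooth_on_add[OF S(1) f g]]])
  then show ?thesis
    by (simp add: complex_hessian_def vec_eq_iff dz_add smooth_on_dzbar[OF S(1), THEN d] f g S)
qed

lemma complex_hessian_cmult: 
  assumes S: "open S" "z \<in> S" and f: "smooth_on S f"
  shows "complex_hessian (\<lambda>x. c * f x) z $ \<alpha> $ \<beta> = c * complex_hessian f z $ \<alpha> $ \<beta>"
proof -
  note d = smooth_on_differentiable
  have "dz \<alpha> (dzbar \<beta> (\<lambda>x. c * f x)) z = dz \<alpha> (\<lambda>x. c * dzbar \<beta> f x) z"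
    by (intro dz_cong[OF S] d[OF smooth_on_dzbar[OF S(1) smooth_on_mult[OF S(1) smooth_on_const[OF S(1)] f]]] S)
       (simp add: dzbar_mult d[OF f] dzbar_const)
  then show ?thesis
    by (simp add: complex_hessian_def dz_mult d[OF smooth_on_dzbar[OF S(1) f]] S dz_const)
qed

section \<open>Determinants of block matrices\<close>

lemma sum_UNIV_sum_type: 
  "(\<Sum>k\<in>(UNIV :: ('m::finite + 'n::finite) set). f k) = (\<Sum>i\<in>UNIV. f (Inl i)) + (\<Sum>j\<in>UNIV. f (Inr j))"
  by (subst UNIV_Plus_UNIV[symmetric], subst sum.Plus) auto

lemma prod_UNIV_sum_type:
  "(\<Prod>k\<in>(UNIV :: ('m::finite + 'n::finite) set). f k) = (\<Prod>i\<in>UNIV. f (Inl i)) * (\<Prod>j\<in>UNIV. f (Inr j))"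
  by (subst UNIV_Plus_UNIV[symmetric], subst prod.Plus) auto

lemma permutes_UNIV_iff_bij: "p permutes UNIV \<longleftrightarrow> bij p"
  by (metis bij_imp_permutes permutes_bij UNIV_I)

lemma map_sum_transpose:
  "map_sum (Transposition.transpose a b) id = Transposition.transpose (Inl a) (Inl b)"
  "map_sum id (Transposition.transpose c d) = Transposition.transpose (Inr c) (Inr d)"
proof -
  show "map_sum (Transposition.transpose a b) id = Transposition.transpose (Inl a) (Inl b)"
    by (rule ext, case_tac x) (auto simp: Transposition.transpose_def)
  show "map_sum id (Transposition.transpose c d) = Transposition.transpose (Inr c) (Inr d)"
    by (rule ext, case_tac x) (auto simp: Transposition.transpose_def)
qed

lemma bij_map_sum:
  assumes "bij p" "bij q"
  shows "bij (map_sum p q)"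
proof (rule o_bij)
  have "inv p \<circ> p = id" "inv q \<circ> q = id" "p \<circ> inv p = id" "q \<circ> inv q = id"
    using assms by (simp_all add: bij_def inj_iff surj_iff)
  then show "map_sum (inv p) (inv q) \<circ> map_sum p q = id" "map_sum p q \<circ> map_sum (inv p) (inv q) = id"
    by (simp_all only: map_sum.comp map_sum.id)
qed

lemma permutation_bij_finite: "bij (p :: 'a::finite \<Rightarrow> 'a) \<Longrightarrow> permutation p"
  using permutes_imp_permutation[of UNIV p] by (simp add: permutes_UNIV_iff_bij)

text \<open>Acting on one summand at a time, the sign can be computed by writing the permutation as a product of
  transpositions, each of which remains a transposition of the sum type.\<close>

lemma sign_map_sum:
  fixes p :: "'m::finite \<Rightarrow> 'm" and q :: "'n::finite \<Rightarrow> 'n"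
  assumes p: "p permutes UNIV" and q: "q permutes UNIV"
  shows "sign (map_sum p q) = sign p * sign q"
proof -
  have L: "sign (map_sum p (id :: 'n \<Rightarrow> 'n)) = sign p"
    using p finite
  proof (induction rule: permutes_induct)
    case id show ?case unfolding map_sum.id by simp
  next
    case (swap a b p)
    have "map_sum (Transposition.transpose a b \<circ> p) (id :: 'n \<Rightarrow> 'n)
        = Transposition.transpose (Inl a) (Inl b :: 'm + 'n) \<circ> map_sum p id"
      unfolding map_sum_transpose[symmetric] map_sum.comp by simp
    moreover have "sign (Transposition.transpose (Inl a) (Inl b :: 'm + 'n) \<circ> map_sum p (id :: 'n \<Rightarrow> 'n))
        = sign (Transposition.transpose (Inl a) (Inl b :: 'm + 'n)) * sign (map_sum p (id :: 'n \<Rightarrow> 'n))"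
      using swap by (intro sign_compose permutation_bij_finite bij_map_sum) (simp_all add: permutes_UNIV_iff_bij)
    moreover have "sign (Transposition.transpose a b \<circ> p) = sign (Transposition.transpose a b) * sign p"
      using swap by (intro sign_compose permutation_bij_finite) (simp_all add: permutes_UNIV_iff_bij)
    ultimately show ?case using swap by (simp only: sign_swap_id sum.inject)
  qed
  have R: "sign (map_sum (id :: 'm \<Rightarrow> 'm) q) = sign q"
    using q finite
  proof (induction rule: permutes_induct)
    case id show ?case unfolding map_sum.id by simp
  next
    case (swap a b q)
    have "map_sum (id :: 'm \<Rightarrow> 'm) (Transposition.transpose a b \<circ> q)
        = Transposition.transpose (Inr a :: 'm + 'n) (Inr b) \<circ> map_sum id q"
      unfolding map_sum_transpose[symmetric] map_sum.comp by simp
    moreover have "sign (Transposition.transpose (Inr a) (Inr b :: 'm + 'n) \<circ> map_sum (id :: 'm \<Rightarrow> 'm) q)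
        = sign (Transposition.transpose (Inr a) (Inr b :: 'm + 'n)) * sign (map_sum (id :: 'm \<Rightarrow> 'm) q)"
      using swap by (intro sign_compose permutation_bij_finite bij_map_sum) (simp_all add: permutes_UNIV_iff_bij)
    moreover have "sign (Transposition.transpose a b \<circ> q) = sign (Transposition.transpose a b) * sign q"
      using swap by (intro sign_compose permutation_bij_finite) (simp_all add: permutes_UNIV_iff_bij)
    ultimately show ?case using swap by (simp only: sign_swap_id sum.inject)
  qed
  have "map_sum p q = map_sum p id \<circ> map_sum id q" by (simp add: map_sum.comp)
  then show ?thesis
    using L R p q
    by (simp add: sign_compose permutation_bij_finite bij_map_sum permutes_UNIV_iff_bij)
qed

text \<open>By finiteness a permutation that maps the first block into itself maps it onto itself, and therefore
  preserves the second block as well.\<close>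

lemma permutation_of_blocks:
  fixes p :: "'m::finite + 'n::finite \<Rightarrow> 'm + 'n"
  assumes p: "p permutes UNIV" and pres: "\<And>i. p (Inl i) \<in> range Inl"
  shows "\<exists>a b. a permutes UNIV \<and> b permutes UNIV \<and> p = map_sum a b"
proof -
  have inj: "inj p" using p by (rule permutes_inj)
  obtain a where a: "\<And>i. p (Inl i) = Inl (a i)" using pres[unfolded image_iff] by metis
  have "inj a"
  proof (rule injI)
    fix i j assume "a i = a j"
    then have "p (Inl i) = p (Inl j)" by (simp add: a)
    then show "i = j" using injD[OF inj] by blast
  qed
  then have sa: "bij a" using finite_UNIV_inj_surj[OF finite] by (intro bijI)
  have "\<exists>j'. p (Inr j) = Inr j'" for j
  proof (cases "p (Inr j)")
    case (Inl i)
    obtain i' where "i = a i'" using surjD[OF bij_is_surj[OF sa]] ..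
    then have "p (Inl i') = p (Inr j)" by (simp only: a Inl)
    then show ?thesis using injD[OF inj] by blast
  qed auto
  then obtain b where b: "\<And>j. p (Inr j) = Inr (b j)" by metis
  have "inj b"
  proof (rule injI)
    fix i j assume "b i = b j"
    then have "p (Inr i) = p (Inr j)" by (simp add: b)
    then show "i = j" using injD[OF inj] by blast
  qed
  then have sb: "bij b" using finite_UNIV_inj_surj[OF finite] by (intro bijI)
  have "p = map_sum a b"
    by (rule ext, case_tac x) (simp_all add: a b)
  with sa sb show ?thesis unfolding permutes_UNIV_iff_bij by blast
qed

text \<open>In the Leibniz expansion a permutation that moves an index of the first block to the second meets a zero
  entry. The others are pairs of permutations of the blocks, and their terms factor.\<close>

lemma det_block_lower_triangular:
  fixes M :: "'a::comm_ring_1^('m::finite + 'n::finite)^('m + 'n)"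
  assumes "\<And>i j. M $ Inl i $ Inr j = 0"
  shows "det M = det (\<chi> i j. M $ Inl i $ Inl j) * det (\<chi> i j. M $ Inr i $ Inr j)"
proof -
  let ?P = "{p. p permutes (UNIV :: ('m + 'n) set)}"
  let ?A = "{p. p permutes (UNIV :: 'm set)}" and ?B = "{p. p permutes (UNIV :: 'n set)}"
  let ?h = "\<lambda>(a, b). map_sum a b"
  let ?t = "\<lambda>p. of_int (sign p) * (\<Prod>k\<in>UNIV. M $ k $ p k)"
  have sub: "?h ` (?A \<times> ?B) \<subseteq> ?P" by (auto simp: permutes_UNIV_iff_bij bij_map_sum)
  have zero: "?t p = 0" if "p \<in> ?P - ?h ` (?A \<times> ?B)" for p
  proof -
    have "\<not> (\<forall>i. p (Inl i) \<in> range Inl)"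
    proof
      assume "\<forall>i. p (Inl i) \<in> range Inl"
      with that permutation_of_blocks[of p] obtain a b
        where "a permutes UNIV" "b permutes UNIV" "p = map_sum a b" by blast
      with that show False by auto
    qed
    then obtain i where i: "p (Inl i) \<notin> range Inl" by blast
    obtain j where "p (Inl i) = Inr j" using i by (cases "p (Inl i)") auto
    then have "M $ Inl i $ p (Inl i) = 0" using assms by simp
    then have "(\<Prod>k\<in>UNIV. M $ k $ p k) = 0" by (intro prod_zero) auto
    then show ?thesis by simp
  qed
  have inj: "inj_on ?h (?A \<times> ?B)"
  proof (rule inj_onI, clarify)
    fix a b a' b' assume eq: "map_sum a b = (map_sum a' b' :: 'm + 'n \<Rightarrow> 'm + 'n)"
    have "a i = a' i" for i using fun_cong[OF eq, of "Inl i"] by simp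
    moreover have "b j = b' j" for j using fun_cong[OF eq, of "Inr j"] by simp
    ultimately show "a = a' \<and> b = b'" by auto
  qed
  have "det M = (\<Sum>p\<in>?P. ?t p)" unfolding det_def by simp
  also have "\<dots> = (\<Sum>p\<in>?h ` (?A \<times> ?B). ?t p)"
    by (rule sum.mono_neutral_right[OF _ sub]) (use zero in auto)
  also have "\<dots> = (\<Sum>x\<in>?A \<times> ?B. ?t (?h x))"
    using sum.reindex[OF inj] by (simp add: o_def)
  also have "\<dots> = (\<Sum>(a, b)\<in>?A \<times> ?B. (of_int (sign a) * (\<Prod>i\<in>UNIV. M $ Inl i $ Inl (a i)))
                  * (of_int (sign b) * (\<Prod>j\<in>UNIV. M $ Inr j $ Inr (b j))))"
    by (intro sum.cong) (auto simp: sign_map_sum prod_UNIV_sum_type mult_ac)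
  also have "\<dots> = det (\<chi> i j. M $ Inl i $ Inl j) * det (\<chi> i j. M $ Inr i $ Inr j)"
    unfolding det_def sum_product sum.cartesian_product by simp
  finally show ?thesis .
qed

lemma det_block_upper_triangular:
  fixes M :: "'a::comm_ring_1^('m::finite + 'n::finite)^('m + 'n)"
  assumes "\<And>i j. M $ Inr i $ Inl j = 0"
  shows "det M = det (\<chi> i j. M $ Inl i $ Inl j) * det (\<chi> i j. M $ Inr i $ Inr j)"
proof -
  have "det M = det (transpose M)" by simp
  also have "\<dots> = det (\<chi> i j. transpose M $ Inl i $ Inl j) * det (\<chi> i j. transpose M $ Inr i $ Inr j)"
    by (rule det_block_lower_triangular) (simp add: transpose_def assms)
  also have "\<dots> = det (transpose (\<chi> i j. M $ Inl i $ Inl j)) * det (transpose (\<chi> i j. M $ Inr i $ Inr j))"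
    by (simp add: transpose_def)
  finally show ?thesis by simp
qed

definition block_matrix ::
  "('m::finite \<Rightarrow> 'm \<Rightarrow> 'a) \<Rightarrow> ('m \<Rightarrow> 'n \<Rightarrow> 'a) \<Rightarrow> ('n::finite \<Rightarrow> 'm \<Rightarrow> 'a) \<Rightarrow> ('n \<Rightarrow> 'n \<Rightarrow> 'a)
     \<Rightarrow> 'a^('m + 'n)^('m + 'n)" where
  "block_matrix A B C D = (\<chi> p q. case p of
       Inl i \<Rightarrow> (case q of Inl j \<Rightarrow> A i j | Inr j \<Rightarrow> B i j)
     | Inr i \<Rightarrow> (case q of Inl j \<Rightarrow> C i j | Inr j \<Rightarrow> D i j))"

lemma block_matrix_nth [simp]:
  "block_matrix A B C D $ Inl i $ Inl j = A i j"
  "block_matrix A B C D $ Inl i $ Inr k = B i k"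
  "block_matrix A B C D $ Inr k $ Inl j = C k j"
  "block_matrix A B C D $ Inr k $ Inr l = D k l"
  by (simp_all add: block_matrix_def)

lemma block_matrix_eqI:
  assumes "\<And>i j. M $ Inl i $ Inl j = N $ Inl i $ Inl j" "\<And>i j. M $ Inl i $ Inr j = N $ Inl i $ Inr j"
    "\<And>i j. M $ Inr i $ Inl j = N $ Inr i $ Inl j" "\<And>i j. M $ Inr i $ Inr j = N $ Inr i $ Inr j"
  shows "M = N"
  unfolding vec_eq_iff
proof (intro allI)
  fix p q show "M $ p $ q = N $ p $ q" by (cases p; cases q) (simp_all add: assms)
qed

lemma block_matrix_mult_nth:
  fixes M N :: "'a::semiring_1^('m::finite + 'n::finite)^('m + 'n)"
  shows "(M ** N) $ p $ q = (\<Sum>i\<in>UNIV. M $ p $ Inl i * N $ Inl i $ q) + (\<Sum>j\<in>UNIV. M $ p $ Inr j * N $ Inr j $ q)"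
  by (simp add: matrix_matrix_mult_def sum_UNIV_sum_type)

abbreviation kron :: "'n \<Rightarrow> 'n \<Rightarrow> 'a::zero_neq_one" where
  "kron i j \<equiv> (if i = j then 1 else 0)"

lemma det_kron: "det (\<chi> i j. kron i j) = 1"
  using det_I by (simp add: mat_def)

lemma kron_mult [simp]:
  fixes c :: "'a::semiring_1"
  shows "kron i j * c = (if i = j then c else 0)" "c * kron i j = (if i = j then c else 0)"
  by auto

text \<open>Border the matrix by one row and column. Multiplying
  \<open>K = [I, -x; y, 1]\<close> by the unipotent \<open>U = [I, x; 0, 1]\<close> on the right and on the left gives two
  triangular matrices; the diagonal of one carries \<open>1 + \<Sum> x\<^sub>i y\<^sub>i\<close>, that of the other \<open>I + x y\<close>.\<close>

lemma det_identity_plus_rank_one: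
  fixes x y :: "'m::finite \<Rightarrow> 'a::comm_ring_1"
  shows "det (\<chi> i j. kron i j + x i * y j) = 1 + (\<Sum>i\<in>UNIV. x i * y i)"
proof -
  let ?s = "\<Sum>i\<in>UNIV. x i * y i"
  define K where "K = block_matrix kron (\<lambda>i (_::unit). - x i) (\<lambda>_ j. y j) (\<lambda>_ _. 1)"
  define U where "U = block_matrix kron (\<lambda>i (_::unit). x i) (\<lambda>_ j. 0) (\<lambda>_ _. 1)"
  have [simp]: "det (\<chi> (i::unit) (j::unit). (c::'a)) = c" for c
    by (simp add: det_def sign_id UNIV_unit)
  have dU: "det U = 1"
    by (subst det_block_upper_triangular) (simp_all add: U_def det_kron)
  have [simp]: "(\<Sum>k\<in>UNIV. - (if i = k then x k else 0)) = - x i" for i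
    unfolding sum_negf by simp
  have KU: "K ** U = block_matrix kron (\<lambda>_ _. 0) (\<lambda>_ j. y j) (\<lambda>_ _. 1 + ?s)"
    by (rule block_matrix_eqI) (simp_all add: block_matrix_mult_nth K_def U_def mult.commute add.commute)
  have UK: "U ** K = block_matrix (\<lambda>i j. kron i j + x i * y j) (\<lambda>_ _. 0) (\<lambda>_ j. y j) (\<lambda>_ _. 1)"
    by (rule block_matrix_eqI) (simp_all add: block_matrix_mult_nth K_def U_def)
  have "det K = det (K ** U)" by (simp add: det_mul dU)
  also have "\<dots> = 1 + ?s"
    unfolding KU by (subst det_block_lower_triangular) (simp_all add: det_kron)
  finally have "1 + ?s = det K" ..
  also have "\<dots> = det (U ** K)" by (simp add: det_mul dU)
  also have "\<dots> = det (\<chi> i j. kron i j + x i * y j)"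
    unfolding UK by (subst det_block_lower_triangular) simp_all
  finally show ?thesis ..
qed

lemma det_cmult:
  fixes A :: "'a::comm_ring_1^'n^'n"
  shows "det (\<chi> i j. c * A $ i $ j) = c ^ CARD('n) * det A"
  by (simp add: det_def prod.distrib sum_distrib_left mult_ac)

section \<open>Symmetry of second derivatives\<close>

text \<open>Two applications of the mean value theorem: to the increment in direction \<open>w\<close> as a function of the step
  along \<open>v\<close>, then to the first derivative so obtained. The left-hand side is symmetric in \<open>v\<close> and \<open>w\<close>.\<close>

lemma second_difference_mean_value:
  fixes u :: "'a::real_normed_vector \<Rightarrow> real"
  assumes u: "\<And>y. y \<in> S \<Longrightarrow> (u has_derivative u' y) (at y)"
    and u': "\<And>y. y \<in> S \<Longrightarrow> ((\<lambda>y. u' y v) has_derivative u'' y) (at y)"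
    and h: "h > 0" and S: "\<And>s t. 0 \<le> s \<Longrightarrow> s \<le> h \<Longrightarrow> 0 \<le> t \<Longrightarrow> t \<le> h \<Longrightarrow> x + s *\<^sub>R v + t *\<^sub>R w \<in> S"
  shows "\<exists>s t. 0 < s \<and> s < h \<and> 0 < t \<and> t < h \<and>
    u (x + h *\<^sub>R v + h *\<^sub>R w) - u (x + h *\<^sub>R v) - u (x + h *\<^sub>R w) + u x = h * h * u'' (x + s *\<^sub>R v + t *\<^sub>R w) w"
proof -
  have d1: "((\<lambda>s. u (x + s *\<^sub>R v + t *\<^sub>R w)) has_real_derivative u' (x + s *\<^sub>R v + t *\<^sub>R w) v) (at s)"
    if "0 \<le> s" "s \<le> h" "0 \<le> t" "t \<le> h" for s t
  proof -
    have lin: "linear (u' (x + s *\<^sub>R v + t *\<^sub>R w))" using u[OF S[OF that]] by (rule has_derivative_linear)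
    have "((\<lambda>s. x + s *\<^sub>R v + t *\<^sub>R w) has_derivative (\<lambda>r. r *\<^sub>R v)) (at s)"
      by (auto intro!: derivative_eq_intros)
    from has_derivative_compose[OF this u[OF S[OF that]]]
    show ?thesis by (simp add: has_field_derivative_def linear_cmul[OF lin] mult_commute_abs)
  qed
  have d2: "((\<lambda>t. u' (x + s *\<^sub>R v + t *\<^sub>R w) v) has_real_derivative u'' (x + s *\<^sub>R v + t *\<^sub>R w) w) (at t)"
    if "0 \<le> s" "s \<le> h" "0 \<le> t" "t \<le> h" for s t
  proof -
    have lin: "linear (u'' (x + s *\<^sub>R v + t *\<^sub>R w))" using u'[OF S[OF that]] by (rule has_derivative_linear)
    have "((\<lambda>t. x + s *\<^sub>R v + t *\<^sub>R w) has_derivative (\<lambda>r. r *\<^sub>R w)) (at t)"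
      by (auto intro!: derivative_eq_intros)
    from has_derivative_compose[OF this u'[OF S[OF that]]]
    show ?thesis by (simp add: has_field_derivative_def linear_cmul[OF lin] mult_commute_abs)
  qed
  have "((\<lambda>s. u (x + s *\<^sub>R v + h *\<^sub>R w) - u (x + s *\<^sub>R v)) has_real_derivative
      u' (x + s *\<^sub>R v + h *\<^sub>R w) v - u' (x + s *\<^sub>R v) v) (at s)" if "0 \<le> s" "s \<le> h" for s
    using DERIV_diff[OF d1[OF that, of h] d1[OF that, of 0]] h by simp
  from MVT2[OF h this] obtain s where s: "0 < s" "s < h" and
    s_eq: "u (x + h *\<^sub>R v + h *\<^sub>R w) - u (x + h *\<^sub>R v) - (u (x + h *\<^sub>R w) - u x)
       = h * (u' (x + s *\<^sub>R v + h *\<^sub>R w) v - u' (x + s *\<^sub>R v) v)"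
    by auto
  from MVT2[OF h d2[of s]] s obtain t where t: "0 < t" "t < h" and
    t_eq: "u' (x + s *\<^sub>R v + h *\<^sub>R w) v - u' (x + s *\<^sub>R v) v = h * u'' (x + s *\<^sub>R v + t *\<^sub>R w) w"
    by auto
  show ?thesis
    by (intro exI[of _ s] exI[of _ t]) (use s t s_eq t_eq in \<open>auto simp: algebra_simps\<close>)
qed

text \<open>The symmetric second difference over a small parallelogram equals both mixed derivatives, each taken at
  some point of the parallelogram; continuity brings them together at \<open>x\<close>.\<close>

lemma frechet_derivative_commute:
  fixes u :: "'a::real_normed_vector \<Rightarrow> real"
  assumes S: "open S" "x \<in> S" and u: "smooth_on S u"
  shows "frechet_derivative (\<lambda>y. frechet_derivative u (at y) v) (at x) w
       = frechet_derivative (\<lambda>y. frechet_derivative u (at y) w) (at x) v"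
proof -
  define D where "D a b y = frechet_derivative (\<lambda>y. frechet_derivative u (at y) a) (at y) b" for a b y
  have du: "(u has_derivative frechet_derivative u (at y)) (at y)" if "y \<in> S" for y
    using smooth_on_differentiable[OF u that] by (simp add: frechet_derivative_works)
  have ddu: "((\<lambda>y. frechet_derivative u (at y) a) has_derivative (\<lambda>b. D a b y)) (at y)" if "y \<in> S" for y a
    using smooth_on_differentiable[OF smooth_on_frechet_derivative[OF u] that]
    by (simp add: frechet_derivative_works D_def)
  have cont: "isCont (D a b) x" for a b
    using smooth_on_differentiable[OF smooth_on_frechet_derivative[OF smooth_on_frechet_derivative[OF u]] S(2)]
    unfolding D_def by (rule differentiable_imp_continuous_within)
  have "\<bar>D v w x - D w v x\<bar> \<le> e" if "e > 0" for e :: real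
  proof -
    have "\<forall>\<^sub>F y in nhds x. y \<in> S" using S by (simp add: eventually_nhds_in_open)
    moreover have "\<forall>\<^sub>F y in nhds x. dist (D a b y) (D a b x) < e / 2" for a b
      using cont[of a b] half_gt_zero[OF that] unfolding continuous_at tendsto_iff eventually_nhds_conv_at
      by (metis dist_self)
    ultimately have "\<forall>\<^sub>F y in nhds x. y \<in> S \<and> dist (D v w y) (D v w x) < e / 2 \<and> dist (D w v y) (D w v x) < e / 2"
      by (intro eventually_conj)
    then obtain d where d: "d > 0" and dS: "\<And>y. dist y x < d \<Longrightarrow> y \<in> S"
      and d1: "\<And>y. dist y x < d \<Longrightarrow> dist (D v w y) (D v w x) < e / 2"
      and d2: "\<And>y. dist y x < d \<Longrightarrow> dist (D w v y) (D w v x) < e / 2"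
      unfolding eventually_nhds_metric by blast
    \<comment> \<open>small enough for the parallelogram with sides \<open>h v\<close> and \<open>h w\<close> to lie in the ball of radius \<open>d\<close>\<close>
    define h where "h = d / (norm v + norm w + 1)"
    have h: "h > 0" using d by (simp add: h_def add_nonneg_pos)
    have near: "dist (x + s *\<^sub>R v + t *\<^sub>R w) x < d" if "0 \<le> s" "s \<le> h" "0 \<le> t" "t \<le> h" for s t
    proof -
      have "dist (x + s *\<^sub>R v + t *\<^sub>R w) x = norm (s *\<^sub>R v + t *\<^sub>R w)" by (simp add: dist_norm)
      also have "\<dots> \<le> s * norm v + t * norm w"
        using norm_triangle_ineq[of "s *\<^sub>R v" "t *\<^sub>R w"] that by simp
      also have "\<dots> \<le> h * norm v + h * norm w" by (intro add_mono mult_right_mono that) auto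
      also have "\<dots> < h * (norm v + norm w + 1)" using h by (simp add: algebra_simps)
      also have "\<dots> = d" by (simp add: h_def add_nonneg_eq_0_iff)
      finally show ?thesis .
    qed
    have near': "dist (x + s *\<^sub>R w + t *\<^sub>R v) x < d" if "0 \<le> s" "s \<le> h" "0 \<le> t" "t \<le> h" for s t
      using near[OF that(3,4,1,2)] by (simp add: add_ac)
    obtain s t where st: "0 < s" "s < h" "0 < t" "t < h" and
      eq1: "u (x + h *\<^sub>R v + h *\<^sub>R w) - u (x + h *\<^sub>R v) - u (x + h *\<^sub>R w) + u x
          = h * h * D v w (x + s *\<^sub>R v + t *\<^sub>R w)"
      using second_difference_mean_value[of S u "\<lambda>y. frechet_derivative u (at y)" v "\<lambda>y b. D v b y" h x w,
          OF du ddu h dS[OF near]] by blast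
    obtain s' t' where st': "0 < s'" "s' < h" "0 < t'" "t' < h" and
      eq2: "u (x + h *\<^sub>R w + h *\<^sub>R v) - u (x + h *\<^sub>R w) - u (x + h *\<^sub>R v) + u x
          = h * h * D w v (x + s' *\<^sub>R w + t' *\<^sub>R v)"
      using second_difference_mean_value[of S u "\<lambda>y. frechet_derivative u (at y)" w "\<lambda>y b. D w b y" h x v,
          OF du ddu h dS[OF near']] by blast
    have "h * h * D v w (x + s *\<^sub>R v + t *\<^sub>R w) = h * h * D w v (x + s' *\<^sub>R w + t' *\<^sub>R v)"
      using eq1 eq2 unfolding add.commute[of "h *\<^sub>R w"] add.assoc[of x] by linarith
    then have "D v w (x + s *\<^sub>R v + t *\<^sub>R w) = D w v (x + s' *\<^sub>R w + t' *\<^sub>R v)" using h by simp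
    moreover have "dist (D v w (x + s *\<^sub>R v + t *\<^sub>R w)) (D v w x) < e / 2"
      using st by (intro d1 near) auto
    moreover have "dist (D w v (x + s' *\<^sub>R w + t' *\<^sub>R v)) (D w v x) < e / 2"
      using st' by (intro d2 near') auto
    ultimately show ?thesis unfolding dist_real_def by linarith
  qed
  then have "\<bar>D v w x - D w v x\<bar> \<le> 0" by (rule field_le_epsilon[of _ 0, simplified])
  then show ?thesis by (simp add: D_def)
qed

text \<open>Expanded into real second derivatives, an entry and the conjugate of the transposed entry differ only in
  the order of differentiation.\<close>

lemma complex_hessian_hermitian:
  fixes u :: "complex^'n \<Rightarrow> real"
  assumes S: "open S" "z \<in> S" and u: "smooth_on S u"
  shows "cnj (complex_hessian (\<lambda>x. of_real (u x)) z $ \<alpha> $ \<beta>) = complex_hessian (\<lambda>x. of_real (u x)) z $ \<beta> $ \<alpha>"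
proof -
  define D where "D a b = frechet_derivative (\<lambda>y. frechet_derivative u (at y) a) (at z) b" for a b
  have sym: "D a b = D b a" for a b
    unfolding D_def by (rule frechet_derivative_commute[OF S u])
  have du: "(u has_derivative frechet_derivative u (at y)) (at y)" if "y \<in> S" for y
    using smooth_on_differentiable[OF u that] by (simp add: frechet_derivative_works)
  have ddu: "((\<lambda>y. frechet_derivative u (at y) a) has_derivative D a) (at z)" for a
    using smooth_on_differentiable[OF smooth_on_frechet_derivative[OF u] S(2)]
    by (simp add: frechet_derivative_works D_def[abs_def])
  have U: "smooth_on S (\<lambda>x. complex_of_real (u x))"
    by (rule smooth_on_bounded_linear[OF bounded_linear_of_real S(1) u])
  have hess: "complex_hessian (\<lambda>x. of_real (u x)) z $ \<alpha> $ \<beta>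
      = (of_real (D (axis \<beta> 1) (axis \<alpha> 1)) + \<i> * of_real (D (axis \<beta> \<i>) (axis \<alpha> 1))
         - \<i> * (of_real (D (axis \<beta> 1) (axis \<alpha> \<i>)) + \<i> * of_real (D (axis \<beta> \<i>) (axis \<alpha> \<i>)))) / 4" for \<alpha> \<beta>
  proof -
    let ?g = "\<lambda>y. (complex_of_real (frechet_derivative u (at y) (axis \<beta> 1))
                    + \<i> * of_real (frechet_derivative u (at y) (axis \<beta> \<i>))) / 2"
    have "dzbar \<beta> (\<lambda>x. of_real (u x)) y = ?g y" if "y \<in> S" for y
      by (rule dzbar_eqI) (rule has_derivative_of_real[OF du[OF that]])
    then have "dz \<alpha> (dzbar \<beta> (\<lambda>x. of_real (u x))) z = dz \<alpha> ?g z"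
      by (intro dz_cong[OF S] smooth_on_differentiable[OF smooth_on_dzbar[OF S(1) U] S(2)])
    moreover have "(?g has_derivative (\<lambda>b. (of_real (D (axis \<beta> 1) b) + \<i> * of_real (D (axis \<beta> \<i>) b)) / 2)) (at z)"
      using ddu by (auto intro!: derivative_eq_intros)
    ultimately have "dz \<alpha> (dzbar \<beta> (\<lambda>x. of_real (u x))) z
        = ((of_real (D (axis \<beta> 1) (axis \<alpha> 1)) + \<i> * of_real (D (axis \<beta> \<i>) (axis \<alpha> 1))) / 2
          - \<i> * ((of_real (D (axis \<beta> 1) (axis \<alpha> \<i>)) + \<i> * of_real (D (axis \<beta> \<i>) (axis \<alpha> \<i>))) / 2)) / 2"
      by (simp only: dz_eqI)
    then show ?thesis
      by (simp add: complex_hessian_def diff_divide_distrib add_divide_distrib algebra_simps)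
  qed
  show ?thesis
    unfolding hess by (simp add: sym[of "axis \<alpha> _"] field_simps)
qed

section \<open>Positive definite Hermitian matrices\<close>

text \<open>A vector \<open>x\<close> in the kernel of \<open>M\<close> makes the form vanish at its conjugate, because the form pairs its second
  index with \<open>cnj w\<close>.\<close>

lemma det_ne_0_if_form_ne_0:
  fixes M :: "complex^'n^'n"
  assumes "\<And>w. w \<noteq> 0 \<Longrightarrow> (\<Sum>\<alpha>\<in>UNIV. \<Sum>\<beta>\<in>UNIV. M $ \<alpha> $ \<beta> * w $ \<alpha> * cnj (w $ \<beta>)) \<noteq> 0"
  shows "det M \<noteq> 0"
proof -
  have "x = 0" if x: "M *v x = 0" for x
  proof (rule ccontr)
    assume "x \<noteq> 0"
    define w where "w = (\<chi> \<beta>. cnj (x $ \<beta>))"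
    have "w \<noteq> 0" using \<open>x \<noteq> 0\<close> by (auto simp: w_def vec_eq_iff)
    moreover have "(\<Sum>\<alpha>\<in>UNIV. \<Sum>\<beta>\<in>UNIV. M $ \<alpha> $ \<beta> * w $ \<alpha> * cnj (w $ \<beta>))
        = (\<Sum>\<alpha>\<in>UNIV. w $ \<alpha> * (M *v x) $ \<alpha>)"
      by (simp add: w_def matrix_vector_mult_def sum_distrib_left mult_ac)
    ultimately show False using assms[of w] x by simp
  qed
  then have "invertible M" by (simp add: invertible_left_inverse matrix_left_invertible_ker)
  then show ?thesis by (simp add: invertible_det_nz)
qed

text \<open>Along the segment from the identity to \<open>H\<close> the determinant is real, since the matrices are Hermitian, and
  never zero, since they are positive definite. It starts at 1 and so stays positive.\<close>

lemma det_pos_if_hermitian_posdef: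
  fixes H :: "complex^'n^'n"
  assumes herm: "\<And>\<alpha> \<beta>. cnj (H $ \<alpha> $ \<beta>) = H $ \<beta> $ \<alpha>"
    and pos: "\<And>w. w \<noteq> 0 \<Longrightarrow> 0 < Re (\<Sum>\<alpha>\<in>UNIV. \<Sum>\<beta>\<in>UNIV. H $ \<alpha> $ \<beta> * w $ \<alpha> * cnj (w $ \<beta>))"
  shows "det H \<in> \<real>" "0 < Re (det H)"
proof -
  \<comment> \<open>the segment from the identity to \<open>H\<close>\<close>
  define M where "M s = (\<chi> \<alpha> \<beta>. of_real (1 - s) * (if \<alpha> = \<beta> then 1 else 0) + of_real s * H $ \<alpha> $ \<beta>)" for s :: real
  have real: "Im (det (M s)) = 0" for s
  proof -
    have "cnj (M s $ \<alpha> $ \<beta>) = M s $ \<beta> $ \<alpha>" for \<alpha> \<beta>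
      by (simp add: M_def herm)
    then have "cnj (det (M s)) = det (transpose (M s))"
      by (simp add: det_def transpose_def)
    then show ?thesis by (metis det_transpose complex_cnj_cancel_iff cnj.sel(2) complex_eq_iff neg_equal_zero)
  qed
  have ne: "det (M s) \<noteq> 0" if "0 \<le> s" "s \<le> 1" for s
  proof (rule det_ne_0_if_form_ne_0)
    fix w :: "complex^'n" assume w: "w \<noteq> 0"
    let ?q = "\<lambda>A :: complex^'n^'n. \<Sum>\<alpha>\<in>UNIV. \<Sum>\<beta>\<in>UNIV. A $ \<alpha> $ \<beta> * w $ \<alpha> * cnj (w $ \<beta>)"
    have "?q (M s) = (\<Sum>\<alpha>\<in>UNIV. \<Sum>\<beta>\<in>UNIV. of_real (1 - s) * (if \<alpha> = \<beta> then w $ \<alpha> * cnj (w $ \<beta>) else 0)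
                     + of_real s * (H $ \<alpha> $ \<beta> * w $ \<alpha> * cnj (w $ \<beta>)))"
      by (intro sum.cong refl) (simp add: M_def algebra_simps)
    also have "\<dots> = of_real (1 - s) * (\<Sum>\<alpha>\<in>UNIV. w $ \<alpha> * cnj (w $ \<alpha>)) + of_real s * ?q H"
      unfolding sum.distrib sum_distrib_left[symmetric] by simp
    also have "(\<Sum>\<alpha>\<in>UNIV. w $ \<alpha> * cnj (w $ \<alpha>)) = of_real ((norm w)\<^sup>2)"
      by (simp add: norm_vec_def L2_set_def sum_nonneg complex_norm_square del: of_real_power)
    finally have "Re (?q (M s)) = (1 - s) * (norm w)\<^sup>2 + s * Re (?q H)" by simp
    moreover have "(1 - s) * (norm w)\<^sup>2 + s * Re (?q H) > 0"
    proof (cases "s = 0")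
      case False
      then show ?thesis using that pos[OF w] by (intro add_nonneg_pos) auto
    qed (use w in simp)
    ultimately show "?q (M s) \<noteq> 0" by (metis less_irrefl zero_complex.sel(1))
  qed
  have M1: "M 1 = H" by (simp add: M_def vec_eq_iff)
  have M0: "det (M 0) = 1" by (simp add: M_def flip: mat_def)
  show "det H \<in> \<real>" using real[of 1] by (simp add: M1 complex_is_Real_iff)
  show "0 < Re (det H)"
  proof (rule ccontr)
    assume neg: "\<not> 0 < Re (det H)"
    have "continuous_on {0..1} (\<lambda>s. Re (det (M s)))"
      unfolding det_def M_def by (intro continuous_intros)
    with neg M0 M1 obtain s where "0 \<le> s" "s \<le> 1" "Re (det (M s)) = 0"
      using IVT2'[of "\<lambda>s. Re (det (M s))" 1 0 0] by auto
    with ne[of s] real[of s] show False by (simp add: complex_eq_iff)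
  qed
qed

section \<open>The matrix of a Hartogs metric\<close>

text \<open>The pointwise linear algebra, separated from the calculus. At a point \<open>(z\<^sub>0, z)\<close> of \<open>\<Omega>\<close> the parameters
  are \<open>e = 1 / \<phi>\<close>, \<open>t = \<parallel>z\<^sub>0\<parallel>\<^sup>2 / \<phi>\<close>, \<open>s = 1 / (1 - t)\<close>, the coordinates of \<open>z\<^sub>0\<close> with their conjugates, the
  two kinds of first derivatives of \<open>u = - log \<phi>\<close>, and the matrix of \<open>g\<^sup>D\<close>; \<open>G\<close> is then the matrix of the
  metric of \<open>\<Omega>\<close>. The coordinates and their conjugates are independent variables here, and so are
  \<open>ua\<close> and \<open>ub\<close>.\<close>

locale hartogs_matrix =
  fixes e t s :: complex and z zb :: "'m::finite \<Rightarrow> complex" and ua ub :: "'n::finite \<Rightarrow> complex"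
    and g :: "'n \<Rightarrow> 'n \<Rightarrow> complex"
  assumes t_eq: "e * (\<Sum>i\<in>UNIV. z i * zb i) = t" and s_eq: "s * (1 - t) = 1"
begin

definition G :: "complex^('m + 'n)^('m + 'n)" where
  "G = block_matrix
     (\<lambda>i j. e * s * kron i j + e\<^sup>2 * s\<^sup>2 * zb i * z j) (\<lambda>i b. e * s\<^sup>2 * zb i * ub b)
     (\<lambda>a j. e * s\<^sup>2 * ua a * z j) (\<lambda>a b. s * g a b + t * s\<^sup>2 * ua a * ub b)"

lemma s_t: "s * t = s - 1"
  using s_eq by (simp add: algebra_simps)

text \<open>Up to the factor \<open>ub b\<close> the right-hand side is the correction that turns column \<open>b\<close> of \<open>G\<close> into
  \<open>G\<close> applied to the antiholomorphic horizontal lift, whose component along the antiholomorphic vertical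
  direction \<open>j\<close> is \<open>- ub b * zb j\<close>.\<close>

lemma G_times_lift:
  "(\<Sum>j\<in>UNIV. G $ p $ Inl j * zb j) = (case p of Inl i \<Rightarrow> e * s\<^sup>2 * zb i | Inr a \<Rightarrow> t * s\<^sup>2 * ua a)"
proof (cases p)
  case (Inl i)
  have "(\<Sum>j\<in>UNIV. G $ p $ Inl j * zb j)
      = (\<Sum>j\<in>UNIV. kron i j * (e * s * zb j)) + e * s\<^sup>2 * zb i * (e * (\<Sum>j\<in>UNIV. z j * zb j))"
    unfolding sum_distrib_left sum.distrib[symmetric]
    by (intro sum.cong) (auto simp: Inl G_def algebra_simps power2_eq_square)
  also have "\<dots> = e * s * zb i * (1 + s * t)"
    by (simp add: t_eq algebra_simps power2_eq_square)
  also have "\<dots> = e * s\<^sup>2 * zb i"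
    by (simp add: s_t power2_eq_square)
  finally show ?thesis by (simp add: Inl)
next
  case (Inr a)
  have "(\<Sum>j\<in>UNIV. G $ p $ Inl j * zb j) = s\<^sup>2 * ua a * (e * (\<Sum>j\<in>UNIV. z j * zb j))"
    unfolding sum_distrib_left by (simp add: Inr G_def mult_ac)
  then show ?thesis by (simp add: Inr t_eq mult_ac)
qed

text \<open>Replacing the coordinate columns of the second block by horizontal lifts is a unipotent operation. It
  clears the upper right block and leaves \<open>s g\<close> in the lower right one, while the upper left block is a
  multiple of the identity plus a matrix of rank one.\<close>

lemma det_G: "det G = e ^ CARD('m) * s ^ (CARD('m) + CARD('n) + 1) * det (\<chi> a b. g a b)"
proof -
  \<comment> \<open>the columns of the second block are the antiholomorphic horizontal lifts\<close>
  define R where "R = block_matrix kron (\<lambda>j b. - (zb j * ub b)) (\<lambda>b j. 0) kron"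
  have R: "det R = 1"
    by (subst det_block_upper_triangular) (simp_all add: R_def det_kron)
  have GR: "G ** R = block_matrix (\<lambda>i j. e * s * (kron i j + (e * s * zb i) * z j)) (\<lambda>_ _. 0)
      (\<lambda>a j. e * s\<^sup>2 * ua a * z j) (\<lambda>a b. s * g a b)" (is "_ = ?N")
  proof (rule block_matrix_eqI)
    have *: "(G ** R) $ p $ Inr b = G $ p $ Inr b - (\<Sum>j\<in>UNIV. G $ p $ Inl j * zb j) * ub b" for p b
      by (simp add: block_matrix_mult_nth R_def sum_distrib_right sum_negf mult.assoc)
    show "(G ** R) $ Inl i $ Inr b = ?N $ Inl i $ Inr b" for i b
      unfolding * G_times_lift by (simp add: G_def)
    show "(G ** R) $ Inr a $ Inr b = ?N $ Inr a $ Inr b" for a b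
      unfolding * G_times_lift by (simp add: G_def)
    have "(G ** R) $ p $ Inl j = G $ p $ Inl j" for p j
      by (simp add: block_matrix_mult_nth R_def)
    then show "(G ** R) $ Inl i $ Inl j = ?N $ Inl i $ Inl j" "(G ** R) $ Inr a $ Inl j = ?N $ Inr a $ Inl j" for i j a
      by (simp_all add: G_def algebra_simps power2_eq_square)
  qed
  have A: "det (\<chi> i j. e * s * (kron i j + (e * s * zb i) * z j)) = (e * s) ^ CARD('m) * s"
  proof -
    have "det (\<chi> i j. e * s * (kron i j + (e * s * zb i) * z j))
        = (e * s) ^ CARD('m) * (1 + (\<Sum>i\<in>UNIV. (e * s * zb i) * z i))"
      using det_cmult[of "e * s" "\<chi> i j. kron i j + (e * s * zb i) * z j"]
        det_identity_plus_rank_one[of "\<lambda>i. e * s * zb i" z] by simp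
    also have "(\<Sum>i\<in>UNIV. (e * s * zb i) * z i) = s * (e * (\<Sum>i\<in>UNIV. z i * zb i))"
      unfolding sum_distrib_left by (simp add: mult_ac)
    finally show ?thesis by (simp add: t_eq s_t)
  qed
  have "det G = det (G ** R)" by (simp add: det_mul R)
  also have "\<dots> = (e * s) ^ CARD('m) * s * (s ^ CARD('n) * det (\<chi> a b. g a b))"
    unfolding GR using det_cmult[of s "\<chi> a b. g a b"]
    by (subst det_block_lower_triangular) (simp_all add: A[simplified])
  finally show ?thesis by (simp add: power_mult_distrib power_add mult_ac)
qed

text \<open>The right-hand side is the matrix of the pulled back metric of \<open>D\<close>. Where \<open>G\<close> is
  invertible, the second factor on the left is therefore the inverse of \<open>G\<close> times the pullback, given explicitly;
  its trace is visible.\<close>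

lemma G_times_lift_block:
  "G ** block_matrix (\<lambda>_ _. 0) (\<lambda>j b. - (1 - t) * zb j * ub b) (\<lambda>_ _. 0) (\<lambda>a b. (1 - t) * kron a b)
     = block_matrix (\<lambda>_ _. 0) (\<lambda>_ _. 0) (\<lambda>_ _. 0) g" (is "G ** ?Y = ?P")
proof (rule block_matrix_eqI)
  have *: "(G ** ?Y) $ p $ Inr b = (1 - t) * (G $ p $ Inr b - (\<Sum>j\<in>UNIV. G $ p $ Inl j * zb j) * ub b)" for p b
  proof -
    have "(\<Sum>k\<in>UNIV. G $ p $ Inr k * ((1 - t) * kron k b)) = (1 - t) * G $ p $ Inr b"
    proof -
      have "(\<Sum>k\<in>UNIV. G $ p $ Inr k * ((1 - t) * kron k b))
          = (\<Sum>k\<in>UNIV. if k = b then (1 - t) * G $ p $ Inr b else 0)"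
        by (intro sum.cong) auto
      then show ?thesis by simp
    qed
    moreover have "(\<Sum>j\<in>UNIV. G $ p $ Inl j * (- (1 - t) * zb j * ub b))
        = - (1 - t) * ((\<Sum>j\<in>UNIV. G $ p $ Inl j * zb j) * ub b)"
      unfolding sum_distrib_left sum_distrib_right by (simp add: mult_ac)
    ultimately show ?thesis by (simp add: block_matrix_mult_nth algebra_simps)
  qed
  show "(G ** ?Y) $ Inl i $ Inr b = ?P $ Inl i $ Inr b" for i b
    unfolding * G_times_lift by (simp add: G_def)
  show "(G ** ?Y) $ Inr a $ Inr b = ?P $ Inr a $ Inr b" for a b
  proof -
    have "(1 - t) * (s * g a b) = (s * (1 - t)) * g a b" by (simp only: mult_ac)
    then show ?thesis unfolding * G_times_lift by (simp add: G_def s_eq)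
  qed
qed (simp_all add: block_matrix_mult_nth)

text \<open>The right-hand side consists of the antiholomorphic first derivatives of \<open>t\<close>; so the multiple
  \<open>(1 - t)\<^sup>2\<close> of the vertical Euler field is the gradient of \<open>t\<close>.\<close>

lemma euler_times_G:
  "(\<Sum>i\<in>UNIV. (1 - t)\<^sup>2 * z i * G $ Inl i $ q) = (case q of Inl j \<Rightarrow> e * z j | Inr b \<Rightarrow> t * ub b)"
proof -
  have s2: "(1 - t)\<^sup>2 * s\<^sup>2 = 1" using s_eq by (simp flip: power_mult_distrib add: mult.commute)
  show ?thesis
  proof (cases q)
    case (Inl j)
    have "(\<Sum>i\<in>UNIV. z i * G $ Inl i $ q)
        = (\<Sum>i\<in>UNIV. kron i j * (e * s * z i)) + e * s\<^sup>2 * z j * (e * (\<Sum>i\<in>UNIV. z i * zb i))"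
      unfolding sum_distrib_left sum.distrib[symmetric]
      by (intro sum.cong) (auto simp: Inl G_def algebra_simps power2_eq_square)
    also have "\<dots> = e * s * z j * (1 + s * t)"
      by (simp add: t_eq algebra_simps power2_eq_square)
    also have "\<dots> = s\<^sup>2 * (e * z j)"
      by (simp add: s_t power2_eq_square)
    finally have "(1 - t)\<^sup>2 * (\<Sum>i\<in>UNIV. z i * G $ Inl i $ q) = (1 - t)\<^sup>2 * s\<^sup>2 * (e * z j)"
      by (simp add: mult.assoc)
    then show ?thesis by (simp add: Inl s2 sum_distrib_left mult.assoc)
  next
    case (Inr b)
    have "(\<Sum>i\<in>UNIV. z i * G $ Inl i $ q) = s\<^sup>2 * ub b * (e * (\<Sum>i\<in>UNIV. z i * zb i))"
      unfolding sum_distrib_left by (simp add: Inr G_def mult_ac)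
    also have "\<dots> = s\<^sup>2 * (t * ub b)" by (simp add: t_eq mult_ac)
    finally have "(1 - t)\<^sup>2 * (\<Sum>i\<in>UNIV. z i * G $ Inl i $ q) = (1 - t)\<^sup>2 * s\<^sup>2 * (t * ub b)"
      by (simp add: mult.assoc)
    then show ?thesis by (simp add: Inr s2 sum_distrib_left mult.assoc)
  qed
qed

end

section \<open>Pullback from the base and traces\<close>

lemma bounded_linear_snd_block: "bounded_linear (snd_block :: complex^('m::finite + 'n) \<Rightarrow> complex^('n::finite))"
proof -
  have "linear (snd_block :: complex^('m + 'n) \<Rightarrow> complex^'n)"
    by (intro linearI) (simp_all add: snd_block_def vec_eq_iff)
  then show ?thesis by (rule linear_conv_bounded_linear[THEN iffD1])
qed

lemma snd_block_axis: "snd_block (axis (Inl i) c) = 0" "snd_block (axis (Inr a) c) = axis a c"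
  by (auto simp: snd_block_def axis_def vec_eq_iff)

lemma dz_pullback:
  fixes f :: "complex^'n::finite \<Rightarrow> complex" and p :: "complex^('m::finite + 'n)"
  assumes "f differentiable (at (snd_block p))"
  shows "dz k (\<lambda>p. f (snd_block p)) p = (case k of Inl i \<Rightarrow> 0 | Inr a \<Rightarrow> dz a f (snd_block p))"
    "dzbar k (\<lambda>p. f (snd_block p)) p = (case k of Inl i \<Rightarrow> 0 | Inr a \<Rightarrow> dzbar a f (snd_block p))"
proof -
  have f: "(f has_derivative frechet_derivative f (at (snd_block p))) (at (snd_block p))"
    using assms by (simp add: frechet_derivative_works)
  note lin = linear_0[OF has_derivative_linear[OF f]]
  have "((\<lambda>p. f (snd_block p)) has_derivative (\<lambda>v. frechet_derivative f (at (snd_block p)) (snd_block v))) (at p)"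
    by (rule has_derivative_compose[OF bounded_linear_imp_has_derivative[OF bounded_linear_snd_block] f])
  from dz_eqI[OF this, of k] dzbar_eqI[OF this, of k]
  show "dz k (\<lambda>p. f (snd_block p)) p = (case k of Inl i \<Rightarrow> 0 | Inr a \<Rightarrow> dz a f (snd_block p))"
    "dzbar k (\<lambda>p. f (snd_block p)) p = (case k of Inl i \<Rightarrow> 0 | Inr a \<Rightarrow> dzbar a f (snd_block p))"
    by (cases k; simp add: snd_block_axis lin dz_def dzbar_def)+
qed

lemma complex_hessian_pullback:
  fixes f :: "complex^'n::finite \<Rightarrow> complex" and p :: "complex^('m::finite + 'n)"
  assumes D: "open D" and T: "open T" "p \<in> T" "snd_block ` T \<subseteq> D" and f: "smooth_on D f"
  shows "complex_hessian (\<lambda>p. f (snd_block p)) p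
    = block_matrix (\<lambda>_ _. 0) (\<lambda>_ _. 0) (\<lambda>_ _. 0) (\<lambda>a b. complex_hessian f (snd_block p) $ a $ b)"
proof -
  note d = smooth_on_differentiable
  have sp: "snd_block q \<in> D" if "q \<in> T" for q using that T by auto
  have sm: "smooth_on T (\<lambda>p. f (snd_block p))"
    by (rule smooth_on_linear_comp[OF bounded_linear_snd_block T(1) D T(3) f])
  have "dz \<alpha> (dzbar \<beta> (\<lambda>p. f (snd_block p))) p = dz \<alpha> (\<lambda>p. case \<beta> of Inl i \<Rightarrow> 0 | Inr b \<Rightarrow> dzbar b f (snd_block p)) p"
    for \<alpha> \<beta> :: "'m + 'n"
    by (intro dz_cong[OF T(1,2)] dz_pullback d[OF f] sp d[OF smooth_on_dzbar[OF T(1) sm] T(2)])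
  moreover have "dz \<alpha> (\<lambda>p. dzbar b f (snd_block p)) p = (case \<alpha> of Inl i \<Rightarrow> 0 | Inr a \<Rightarrow> dz a (dzbar b f) (snd_block p))"
    for \<alpha> :: "'m + 'n" and b
    by (intro dz_pullback d[OF smooth_on_dzbar[OF D f]] sp T)
  ultimately show ?thesis
    by (intro block_matrix_eqI) (simp_all add: complex_hessian_def dz_const)
qed

lemma matrix_inv_two_sided:
  fixes A :: "complex^'n^'n"
  assumes "det A \<noteq> 0" shows "matrix_inv A ** A = mat 1" "A ** matrix_inv A = mat 1"
proof -
  obtain B where "A ** B = mat 1 \<and> B ** A = mat 1"
    using assms by (auto simp: invertible_det_nz[symmetric] invertible_def)
  from someI[of "\<lambda>B. A ** B = mat 1 \<and> B ** A = mat 1", OF this]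
  show "matrix_inv A ** A = mat 1" "A ** matrix_inv A = mat 1" by (simp_all add: matrix_inv_def)
qed

text \<open>The double sum is the trace of the inverse of \<open>A\<close> times \<open>A Y\<close>. This turns the contraction that defines
  the scalar curvature into a trace as soon as the Ricci tensor is written as \<open>A Y\<close>.\<close>

lemma sum_inverse_entries_eq_trace:
  fixes A :: "complex^'n^'n"
  assumes "det A \<noteq> 0"
  shows "(\<Sum>\<alpha>\<in>UNIV. \<Sum>\<beta>\<in>UNIV. matrix_inv A $ \<beta> $ \<alpha> * (A ** Y) $ \<alpha> $ \<beta>) = trace Y"
proof -
  have "(\<Sum>\<alpha>\<in>UNIV. \<Sum>\<beta>\<in>UNIV. matrix_inv A $ \<beta> $ \<alpha> * (A ** Y) $ \<alpha> $ \<beta>)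
      = (\<Sum>\<beta>\<in>UNIV. (matrix_inv A ** (A ** Y)) $ \<beta> $ \<beta>)"
    by (subst sum.swap) (simp add: matrix_matrix_mult_def)
  also have "matrix_inv A ** (A ** Y) = Y"
    by (simp add: matrix_mul_assoc matrix_inv_two_sided[OF assms])
  finally show ?thesis by (simp add: trace_def)
qed

section \<open>Smoothness and first derivatives on a Hartogs domain\<close>

locale hartogs =
  fixes D :: "(complex^'n::finite) set" and \<phi> :: "complex^'n \<Rightarrow> real"
    and \<Omega> :: "(complex^('m::finite + 'n)) set"
  assumes open_D: "open D" and pos: "z \<in> D \<Longrightarrow> 0 < \<phi> z"
    and smooth: "smooth_on D (\<lambda>z. - ln (\<phi> z))"
    and spsh: "strictly_psh_on D (\<lambda>z. - ln (\<phi> z))"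
    and Omega: "\<Omega> = hartogs_domain D \<phi>" and open_Omega: "open \<Omega>"
begin

text \<open>The functions \<open>- log \<phi>\<close>, \<open>1 / \<phi>\<close> and \<open>\<parallel>z\<^sub>0\<parallel>\<^sup>2 / \<phi>\<close> are taken complex valued and expressed through each
  other, \<open>E\<close> as an exponential and \<open>t\<close> as a polynomial in \<open>E\<close> and the coordinates, so that the Wirtinger rules
  apply to them directly.\<close>

definition U :: "complex^'n \<Rightarrow> complex" where "U z = of_real (- ln (\<phi> z))"
definition gD :: "complex^'n \<Rightarrow> complex^'n^'n" where "gD = kahler_metric (\<lambda>z. - ln (\<phi> z))"
definition potential :: "complex^('m + 'n) \<Rightarrow> complex" where
  "potential p = of_real (- ln (\<phi> (snd_block p) - (norm (fst_block p))\<^sup>2))"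
definition gOmega :: "complex^('m + 'n) \<Rightarrow> complex^('m + 'n)^('m + 'n)" where
  "gOmega = kahler_metric (\<lambda>p. - ln (\<phi> (snd_block p) - (norm (fst_block p))\<^sup>2))"

definition E :: "complex^('m + 'n) \<Rightarrow> complex" where "E p = exp (U (snd_block p))"
definition t :: "complex^('m + 'n) \<Rightarrow> complex" where
  "t p = E p * (\<Sum>i\<in>UNIV. p $ Inl i * cnj (p $ Inl i))"

lemma gD_eq: "gD = complex_hessian U" and gOmega_eq: "gOmega = complex_hessian potential"
  by (simp_all add: gD_def gOmega_def kahler_metric_def U_def[abs_def] potential_def[abs_def])

lemma snd_in_D: "p \<in> \<Omega> \<Longrightarrow> snd_block p \<in> D"
  by (simp add: Omega hartogs_domain_def)

lemma snd_image: "snd_block ` \<Omega> \<subseteq> D" using snd_in_D by auto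

lemma smooth_U: "smooth_on D U"
  unfolding U_def[abs_def] by (rule smooth_on_bounded_linear[OF bounded_linear_of_real open_D smooth])

lemma smooth_pullback: "smooth_on D f \<Longrightarrow> smooth_on \<Omega> (\<lambda>p. f (snd_block p))"
  by (rule smooth_on_linear_comp[OF bounded_linear_snd_block open_Omega open_D snd_image])

lemma smooth_coord: "smooth_on \<Omega> (\<lambda>p. p $ i)" and smooth_cnj_coord: "smooth_on \<Omega> (\<lambda>p. cnj (p $ i))"
  by (intro smooth_on_linear[OF _ open_Omega] bounded_linear_vec_nth bounded_linear_cnj_coord)+

lemma smooth_E: "smooth_on \<Omega> E"
  unfolding E_def[abs_def] by (intro smooth_on_exp[OF open_Omega] smooth_pullback smooth_U)

lemma smooth_t: "smooth_on \<Omega> t"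
  unfolding t_def[abs_def]
  by (intro smooth_on_mult[OF open_Omega] smooth_on_sum[OF open_Omega] smooth_E smooth_coord smooth_cnj_coord)

lemma smooth_one_minus_t: "smooth_on \<Omega> (\<lambda>p. 1 - t p)"
  by (intro smooth_on_diff[OF open_Omega] smooth_on_const[OF open_Omega] smooth_t)

lemma E_of_real: "snd_block p \<in> D \<Longrightarrow> E p = of_real (1 / \<phi> (snd_block p))"
proof -
  assume "snd_block p \<in> D"
  then have "exp (- ln (\<phi> (snd_block p))) = 1 / \<phi> (snd_block p)"
    using pos by (simp add: exp_minus inverse_eq_divide)
  then show ?thesis unfolding E_def U_def exp_of_real by simp
qed

lemma t_of_real: "snd_block p \<in> D \<Longrightarrow> t p = of_real ((norm (fst_block p))\<^sup>2 / \<phi> (snd_block p))"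
proof -
  assume "snd_block p \<in> D"
  moreover have "(\<Sum>i\<in>UNIV. p $ Inl i * cnj (p $ Inl i)) = of_real ((norm (fst_block p))\<^sup>2)"
    by (simp add: norm_vec_def L2_set_def sum_nonneg complex_norm_square fst_block_def del: of_real_power)
  ultimately show ?thesis by (simp add: t_def E_of_real)
qed

lemma one_minus_t_pos:
  assumes "p \<in> \<Omega>"
  obtains r where "r > 0" "1 - t p = of_real r" "r = 1 - (norm (fst_block p))\<^sup>2 / \<phi> (snd_block p)"
proof -
  have "(norm (fst_block p))\<^sup>2 / \<phi> (snd_block p) < 1"
    using assms pos by (simp add: Omega hartogs_domain_def)
  then show ?thesis using that snd_in_D[OF assms] by (simp add: t_of_real)
qed

lemma one_minus_t_slit: "p \<in> \<Omega> \<Longrightarrow> 1 - t p \<notin> \<real>\<^sub>\<le>\<^sub>0"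
  by (erule one_minus_t_pos) (simp only: complex_nonpos_Reals_iff, simp)

lemma one_minus_t_ne_0: "p \<in> \<Omega> \<Longrightarrow> 1 - t p \<noteq> 0"
  using one_minus_t_slit by fastforce

lemma potential_eq:
  assumes "p \<in> \<Omega>" shows "potential p = U (snd_block p) - Ln (1 - t p)"
proof -
  obtain r where r: "r > 0" "1 - t p = of_real r" "r = 1 - (norm (fst_block p))\<^sup>2 / \<phi> (snd_block p)"
    using one_minus_t_pos[OF assms] .
  have \<phi>: "\<phi> (snd_block p) > 0" using snd_in_D[OF assms] pos by blast
  have "\<phi> (snd_block p) - (norm (fst_block p))\<^sup>2 = \<phi> (snd_block p) * r"
    using \<phi> r(3) by (simp add: field_simps)
  then have "potential p = of_real (- ln (\<phi> (snd_block p)) - ln r)"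
    using r(1) \<phi> by (simp add: potential_def ln_mult)
  moreover have "Ln (1 - t p) = of_real (ln r)" unfolding r(2) using r(1) by (rule Ln_of_real)
  ultimately show ?thesis by (simp add: U_def)
qed

lemma smooth_Ln_one_minus_t: "smooth_on \<Omega> (\<lambda>p. Ln (1 - t p))"
  by (rule smooth_on_Ln[OF open_Omega one_minus_t_slit smooth_one_minus_t])

lemma smooth_potential: "smooth_on \<Omega> potential"
  by (rule smooth_on_cong[OF open_Omega, of "\<lambda>p. U (snd_block p) - Ln (1 - t p)"])
     (simp_all add: potential_eq smooth_on_diff open_Omega smooth_pullback smooth_U smooth_Ln_one_minus_t)

lemmas differentiable_rules = smooth_on_differentiable[OF smooth_E] smooth_on_differentiable[OF smooth_t]
  smooth_on_differentiable[OF smooth_one_minus_t] smooth_on_differentiable[OF smooth_coord]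
  smooth_on_differentiable[OF smooth_cnj_coord] smooth_on_differentiable[OF smooth_Ln_one_minus_t]
  smooth_on_differentiable[OF smooth_pullback[OF smooth_U]]
  smooth_on_differentiable[OF smooth_pullback[OF smooth_on_dzbar[OF open_D smooth_U]]]

definition ua :: "complex^('m + 'n) \<Rightarrow> 'n \<Rightarrow> complex" where "ua p a = dz a U (snd_block p)"
definition ub :: "complex^('m + 'n) \<Rightarrow> 'n \<Rightarrow> complex" where "ub p b = dzbar b U (snd_block p)"

lemma d_U:
  assumes "p \<in> \<Omega>"
  shows "dz k (\<lambda>p. U (snd_block p)) p = (case k of Inl i \<Rightarrow> 0 | Inr a \<Rightarrow> ua p a)"
    "dzbar k (\<lambda>p. U (snd_block p)) p = (case k of Inl i \<Rightarrow> 0 | Inr a \<Rightarrow> ub p a)"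
  by (cases k; simp add: ua_def ub_def dz_pullback smooth_on_differentiable[OF smooth_U snd_in_D[OF assms]])+

lemma d_E:
  assumes "p \<in> \<Omega>"
  shows "dz k E p = (case k of Inl i \<Rightarrow> 0 | Inr a \<Rightarrow> E p * ua p a)"
    "dzbar k E p = (case k of Inl i \<Rightarrow> 0 | Inr a \<Rightarrow> E p * ub p a)"
proof -
  have "((exp :: complex \<Rightarrow> complex) has_field_derivative E p) (at (U (snd_block p)))"
    unfolding E_def by (rule DERIV_exp)
  from dz_holomorphic_comp[where f = "\<lambda>p. U (snd_block p)", OF this] assms
  show "dz k E p = (case k of Inl i \<Rightarrow> 0 | Inr a \<Rightarrow> E p * ua p a)"
    "dzbar k E p = (case k of Inl i \<Rightarrow> 0 | Inr a \<Rightarrow> E p * ub p a)"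
    by (simp_all add: differentiable_rules d_U E_def[abs_def] split: sum.splits)
qed

lemma smooth_sq: "smooth_on \<Omega> (\<lambda>p. \<Sum>i\<in>UNIV. p $ Inl i * cnj (p $ Inl i))"
  by (intro smooth_on_mult[OF open_Omega] smooth_on_sum[OF open_Omega] smooth_coord smooth_cnj_coord)

text \<open>In the directions of \<open>D\<close> the logarithmic derivatives of \<open>t\<close> are those of \<open>E\<close>; this is what makes the
  horizontal lifts annihilate \<open>t\<close>.\<close>

lemma d_t:
  assumes p: "p \<in> \<Omega>"
  shows "dz k t p = (case k of Inl i \<Rightarrow> E p * cnj (p $ Inl i) | Inr a \<Rightarrow> t p * ua p a)"
    "dzbar k t p = (case k of Inl i \<Rightarrow> E p * p $ Inl i | Inr a \<Rightarrow> t p * ub p a)"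
proof -
  note dc = differentiable_rules(4,5)[OF p]
  have m: "(\<lambda>p. p $ Inl i * cnj (p $ Inl i)) differentiable (at p)" for i
    by (intro differentiable_mult dc)
  have sq: "dz k (\<lambda>p. \<Sum>i\<in>UNIV. p $ Inl i * cnj (p $ Inl i)) p = (case k of Inl i \<Rightarrow> cnj (p $ Inl i) | Inr a \<Rightarrow> 0)"
    "dzbar k (\<lambda>p. \<Sum>i\<in>UNIV. p $ Inl i * cnj (p $ Inl i)) p = (case k of Inl i \<Rightarrow> p $ Inl i | Inr a \<Rightarrow> 0)"
    by (cases k; simp add: dz_sum dzbar_sum m dz_mult dzbar_mult dc dz_coord dzbar_coord dz_cnj_coord dzbar_cnj_coord)+
  note ds = smooth_on_differentiable[OF smooth_sq p]
  show "dz k t p = (case k of Inl i \<Rightarrow> E p * cnj (p $ Inl i) | Inr a \<Rightarrow> t p * ua p a)"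
    "dzbar k t p = (case k of Inl i \<Rightarrow> E p * p $ Inl i | Inr a \<Rightarrow> t p * ub p a)"
    unfolding t_def[abs_def] dz_mult(1)[OF differentiable_rules(1)[OF p] ds] dzbar_mult[OF differentiable_rules(1)[OF p] ds] sq d_E[OF p]
    by (cases k; simp add: mult_ac)+
qed


section \<open>Hessian of the potential and its determinant\<close>

definition s :: "complex^('m + 'n) \<Rightarrow> complex" where "s p = inverse (1 - t p)"

lemma s_mult: "p \<in> \<Omega> \<Longrightarrow> s p * (1 - t p) = 1"
  using one_minus_t_ne_0 by (simp add: s_def)

lemma smooth_s: "smooth_on \<Omega> s"
  unfolding s_def[abs_def] by (rule smooth_on_inverse[OF open_Omega one_minus_t_ne_0 smooth_one_minus_t])

lemma d_one_minus_t:
  assumes "p \<in> \<Omega>"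
  shows "dz k (\<lambda>p. 1 - t p) p = - dz k t p" "dzbar k (\<lambda>p. 1 - t p) p = - dzbar k t p"
  by (simp_all add: dz_diff dzbar_diff differentiable_rules assms dz_const dzbar_const)

lemma d_s:
  assumes p: "p \<in> \<Omega>"
  shows "dz k s p = (s p)\<^sup>2 * dz k t p"
proof -
  have "(inverse has_field_derivative - ((s p)\<^sup>2)) (at (1 - t p))"
    using DERIV_inverse[OF one_minus_t_ne_0[OF p]] by (simp add: s_def power2_eq_square)
  from dz_holomorphic_comp(1)[where f = "\<lambda>p. 1 - t p", OF this differentiable_rules(3)[OF p]]
  show ?thesis by (simp add: s_def[abs_def] d_one_minus_t[OF p])
qed

text \<open>In the directions of \<open>D\<close> the contributions of \<open>u\<close> and of \<open>- log (1 - t)\<close> combine by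
  \<open>1 + t / (1 - t) = 1 / (1 - t)\<close>. This short form keeps the second derivatives manageable.\<close>

lemma dzbar_potential:
  assumes p: "p \<in> \<Omega>"
  shows "dzbar k potential p = (case k of Inl j \<Rightarrow> E p * p $ Inl j * s p | Inr b \<Rightarrow> ub p b * s p)"
proof -
  have "dzbar k potential p = dzbar k (\<lambda>p. U (snd_block p) - Ln (1 - t p)) p"
    using p by (intro dzbar_cong[OF open_Omega] potential_eq smooth_on_differentiable[OF smooth_potential])
  also have "\<dots> = dzbar k (\<lambda>p. U (snd_block p)) p - dzbar k (\<lambda>p. Ln (1 - t p)) p"
    using p by (intro dzbar_diff differentiable_rules)
  also have "dzbar k (\<lambda>p. Ln (1 - t p)) p = s p * dzbar k (\<lambda>p. 1 - t p) p"
    unfolding s_def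
    by (rule dz_holomorphic_comp[OF has_field_derivative_Ln[OF one_minus_t_slit[OF p]] differentiable_rules(3)[OF p]])
  also have "dzbar k (\<lambda>p. U (snd_block p)) p - s p * dzbar k (\<lambda>p. 1 - t p) p
      = (case k of Inl j \<Rightarrow> E p * p $ Inl j * s p | Inr b \<Rightarrow> ub p b * (s p * (1 - t p)) + s p * t p * ub p b)"
    by (cases k) (simp_all add: d_U d_one_minus_t d_t p s_mult)
  also have "\<dots> = (case k of Inl j \<Rightarrow> E p * p $ Inl j * s p | Inr b \<Rightarrow> ub p b * s p)"
    by (cases k) (simp_all add: algebra_simps)
  finally show ?thesis .
qed

lemma hartogs_matrix_at: "p \<in> \<Omega> \<Longrightarrow> hartogs_matrix (E p) (t p) (s p) (\<lambda>i. p $ Inl i) (\<lambda>i. cnj (p $ Inl i))"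
  by standard (rule t_def[symmetric], rule s_mult)

abbreviation G where
  "G p \<equiv> hartogs_matrix.G (E p) (t p) (s p) (\<lambda>i. p $ Inl i) (\<lambda>i. cnj (p $ Inl i)) (ua p) (ub p)
     (\<lambda>a b. gD (snd_block p) $ a $ b)"

lemma smooth_ub: "smooth_on \<Omega> (\<lambda>p. ub p b)"
  unfolding ub_def by (intro smooth_pullback smooth_on_dzbar[OF open_D smooth_U])

lemma dz_ub:
  assumes "p \<in> \<Omega>"
  shows "dz k (\<lambda>p. ub p b) p = (case k of Inl i \<Rightarrow> 0 | Inr a \<Rightarrow> gD (snd_block p) $ a $ b)"
  unfolding ub_def gD_eq complex_hessian_def
  by (cases k; simp add: dz_pullback
      smooth_on_differentiable[OF smooth_on_dzbar[OF open_D smooth_U] snd_in_D[OF assms]])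

lemma gOmega_eq_G:
  assumes p: "p \<in> \<Omega>"
  shows "gOmega p = G p"
proof (rule block_matrix_eqI)
  note d = smooth_on_differentiable
  note st = hartogs_matrix.s_t[OF hartogs_matrix_at[OF p]]
  have 1: "dz \<alpha> (dzbar \<beta> potential) p
      = dz \<alpha> (\<lambda>p. case \<beta> of Inl j \<Rightarrow> E p * p $ Inl j * s p | Inr b \<Rightarrow> ub p b * s p) p" for \<alpha> \<beta>
    by (intro dz_cong[OF open_Omega p] dzbar_potential d[OF smooth_on_dzbar[OF open_Omega smooth_potential] p])
  have Ez: "dz \<alpha> (\<lambda>p. E p * p $ Inl j * s p) p
      = E p * p $ Inl j * ((s p)\<^sup>2 * dz \<alpha> t p) + (E p * kron \<alpha> (Inl j) + dz \<alpha> E p * p $ Inl j) * s p" for \<alpha> j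
  proof -
    have "(\<lambda>p. E p * p $ Inl j) differentiable (at p)"
      by (intro differentiable_mult differentiable_rules p)
    then show ?thesis
      by (simp add: dz_mult differentiable_rules p d[OF smooth_s p] d_s[OF p] dz_coord)
  qed
  have us: "dz \<alpha> (\<lambda>p. ub p b * s p) p = ub p b * ((s p)\<^sup>2 * dz \<alpha> t p) + dz \<alpha> (\<lambda>p. ub p b) p * s p" for \<alpha> b
    by (simp add: dz_mult d[OF smooth_s p] d[OF smooth_ub p] d_s[OF p])
  show "gOmega p $ Inl i $ Inl j = G p $ Inl i $ Inl j" for i j
    unfolding gOmega_eq complex_hessian_def
    by (simp add: 1 Ez d_t[OF p] d_E[OF p] hartogs_matrix.G_def[OF hartogs_matrix_at[OF p]] power2_eq_square)
  show "gOmega p $ Inr a $ Inl j = G p $ Inr a $ Inl j" for a j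
  proof -
    have "gOmega p $ Inr a $ Inl j = E p * p $ Inl j * ua p a * (s p * (s p * t p) + s p)"
      unfolding gOmega_eq complex_hessian_def
      by (simp only: vec_lambda_beta 1 sum.case Ez d_t[OF p] d_E[OF p])
         (simp add: algebra_simps power2_eq_square)
    also have "\<dots> = G p $ Inr a $ Inl j"
      unfolding st by (simp add: hartogs_matrix.G_def[OF hartogs_matrix_at[OF p]] power2_eq_square algebra_simps)
    finally show ?thesis .
  qed
  show "gOmega p $ Inl i $ Inr b = G p $ Inl i $ Inr b" for i b
    unfolding gOmega_eq complex_hessian_def
    by (simp add: 1 us dz_ub[OF p] d_t[OF p] hartogs_matrix.G_def[OF hartogs_matrix_at[OF p]])
  show "gOmega p $ Inr a $ Inr b = G p $ Inr a $ Inr b" for a b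
    unfolding gOmega_eq[THEN fun_cong] complex_hessian_def
    by (simp add: 1 us dz_ub[OF p] d_t[OF p] hartogs_matrix.G_def[OF hartogs_matrix_at[OF p]])
qed

lemma det_gD_pos:
  assumes "z \<in> D"
  obtains \<delta> where "\<delta> > 0" "det (gD z) = of_real \<delta>"
proof -
  have "det (gD z) \<in> \<real>" "0 < Re (det (gD z))"
    unfolding gD_eq U_def[abs_def]
    using det_pos_if_hermitian_posdef[OF complex_hessian_hermitian[OF open_D assms smooth]] spsh assms
    by (auto simp: strictly_psh_on_def)
  then show ?thesis using that[of "Re (det (gD z))"] by (simp add: of_real_Re)
qed

lemma smooth_gD: "smooth_on D (\<lambda>z. gD z $ a $ b)"
  unfolding gD_eq complex_hessian_def by (simp add: smooth_on_dz smooth_on_dzbar open_D smooth_U)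

lemma smooth_Ln_det_gD: "smooth_on D (\<lambda>z. Ln (det (gD z)))"
proof (rule smooth_on_Ln[OF open_D])
  show "det (gD z) \<notin> \<real>\<^sub>\<le>\<^sub>0" if "z \<in> D" for z
    by (rule det_gD_pos[OF that]) simp
qed (intro smooth_on_det open_D smooth_gD)

lemma det_gOmega:
  assumes p: "p \<in> \<Omega>"
  shows "det (gOmega p) = E p ^ CARD('m) * s p ^ (CARD('m) + CARD('n) + 1) * det (gD (snd_block p))"
  using hartogs_matrix.det_G[OF hartogs_matrix_at[OF p], of "ua p" "ub p" "\<lambda>a b. gD (snd_block p) $ a $ b"]
  unfolding gOmega_eq_G[OF p] vec_lambda_eta .

lemma det_gOmega_ne_0: "p \<in> \<Omega> \<Longrightarrow> det (gOmega p) \<noteq> 0"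
proof -
  assume p: "p \<in> \<Omega>"
  have "s p \<noteq> 0" unfolding s_def using one_minus_t_ne_0[OF p] by (rule nonzero_imp_inverse_nonzero)
  moreover have "E p \<noteq> 0" unfolding E_def by (rule exp_not_eq_zero)
  moreover have "det (gD (snd_block p)) \<noteq> 0" by (rule det_gD_pos[OF snd_in_D[OF p]]) simp
  ultimately show ?thesis unfolding det_gOmega[OF p] by simp
qed

text \<open>The logarithm of the determinant is written with the potential of \<open>\<Omega>\<close> in place of \<open>log (1 - t)\<close>, since the
  Hessians of all three summands are then known. The coefficient of \<open>u\<close> is \<open>d\<^sub>0 - (d\<^sub>0 + d + 1)\<close>. Both determinants
  and \<open>1 - t\<close> are positive reals, so the identity holds for the principal branch.\<close>

lemma Ln_det_gOmega:
  assumes p: "p \<in> \<Omega>"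
  shows "Ln (det (gOmega p)) = of_nat (CARD('m) + CARD('n) + 1) * potential p
           + (- of_nat (CARD('n) + 1) * U (snd_block p) + Ln (det (gD (snd_block p))))"
proof -
  let ?N = "CARD('m) + CARD('n) + 1" and ?u = "- ln (\<phi> (snd_block p))"
  obtain r where r: "r > 0" "1 - t p = of_real r" using one_minus_t_pos[OF p] by metis
  obtain \<delta> where \<delta>: "\<delta> > 0" "det (gD (snd_block p)) = of_real \<delta>" using det_gD_pos[OF snd_in_D[OF p]] .
  have "E p = of_real (exp ?u)" by (simp only: E_def U_def exp_of_real)
  moreover have "s p = of_real (inverse r)" by (simp add: s_def r(2))
  ultimately have "det (gOmega p) = of_real (exp ?u ^ CARD('m) * inverse r ^ ?N * \<delta>)"
    unfolding det_gOmega[OF p] \<delta>(2) by (simp only: of_real_mult of_real_power)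
  moreover have "exp ?u ^ CARD('m) * inverse r ^ ?N * \<delta> > 0" using r \<delta> by simp
  moreover have "ln (exp ?u ^ CARD('m) * inverse r ^ ?N * \<delta>) = real CARD('m) * ?u - real ?N * ln r + ln \<delta>"
  proof -
    have "ln (exp ?u ^ CARD('m) * inverse r ^ ?N * \<delta>) = ln (exp ?u ^ CARD('m)) + ln (inverse r ^ ?N) + ln \<delta>"
      using r \<delta> by (subst ln_mult; simp)+
    then show ?thesis using r by (simp only: ln_realpow ln_exp ln_inverse)
  qed
  ultimately have "Ln (det (gOmega p)) = of_real (real CARD('m) * ?u - real ?N * ln r + ln \<delta>)"
    by (simp only: Ln_of_real)
  moreover have "Ln (det (gD (snd_block p))) = of_real (ln \<delta>)" unfolding \<delta>(2) by (rule Ln_of_real[OF \<delta>(1)])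
  moreover have "potential p = of_real (?u - ln r)"
    unfolding potential_eq[OF p] r(2) Ln_of_real[OF r(1)] U_def by simp
  ultimately show ?thesis by (simp only: U_def) (simp add: algebra_simps)
qed


section \<open>Ricci and scalar curvature\<close>

definition gD_pullback :: "complex^('m + 'n) \<Rightarrow> complex^('m + 'n)^('m + 'n)" where
  "gD_pullback p = block_matrix (\<lambda>_ _. 0) (\<lambda>_ _. 0) (\<lambda>_ _. 0) (\<lambda>a b. gD (snd_block p) $ a $ b)"

text \<open>Each summand of \<open>Ln_det_gOmega\<close> has a known Hessian: the metric of \<open>\<Omega>\<close>, the pullback of \<open>g\<^sup>D\<close>, and minus the
  pullback of the Ricci tensor of \<open>D\<close>, which is \<open>c\<close> times the pullback of \<open>g\<^sup>D\<close>.\<close>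

lemma ricci_gOmega:
  assumes c: "einstein_on D gD c" and p: "p \<in> \<Omega>"
  shows "ricci gOmega p $ \<alpha> $ \<beta> = - of_nat (CARD('m) + CARD('n) + 1) * gOmega p $ \<alpha> $ \<beta>
           + of_real (c + real (CARD('n) + 1)) * gD_pullback p $ \<alpha> $ \<beta>"
proof -
  let ?N = "of_nat (CARD('m) + CARD('n) + 1) :: complex" and ?n = "of_nat (CARD('n) + 1) :: complex"
  let ?L = "\<lambda>p. Ln (det (gD (snd_block p)))" and ?V = "\<lambda>p. U (snd_block p)"
  note S = open_Omega p and O = open_Omega
  have L: "smooth_on \<Omega> ?L" by (rule smooth_pullback[OF smooth_Ln_det_gD])
  have V: "smooth_on \<Omega> ?V" by (rule smooth_pullback[OF smooth_U])
  have cm: "smooth_on \<Omega> (\<lambda>p. k * f p)" if "smooth_on \<Omega> f" for k :: complex and f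
    by (rule smooth_on_mult[OF O smooth_on_const[OF O] that])
  have "complex_hessian (\<lambda>p. Ln (det (gOmega p))) p
      = complex_hessian (\<lambda>p. ?N * potential p + (- ?n * ?V p + ?L p)) p"
    by (rule complex_hessian_cong[OF S, symmetric])
       (simp_all only: Ln_det_gOmega, intro smooth_on_add[OF O] cm L V smooth_potential)
  also have "\<dots> = complex_hessian (\<lambda>p. ?N * potential p) p
      + (complex_hessian (\<lambda>p. - ?n * ?V p) p + complex_hessian ?L p)"
    by (simp only: complex_hessian_add[OF S] smooth_on_add[OF O] cm L V smooth_potential)
  finally have "complex_hessian (\<lambda>p. Ln (det (gOmega p))) p $ \<alpha> $ \<beta>
      = ?N * gOmega p $ \<alpha> $ \<beta> + (- ?n * complex_hessian ?V p $ \<alpha> $ \<beta> + complex_hessian ?L p $ \<alpha> $ \<beta>)"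
    by (simp only: vector_add_component complex_hessian_cmult[OF S] smooth_potential V gOmega_eq)
  moreover have "complex_hessian ?V p = gD_pullback p"
    unfolding complex_hessian_pullback[OF open_D S snd_image smooth_U] gD_pullback_def gD_eq ..
  moreover have "complex_hessian ?L p $ \<alpha> $ \<beta> = - of_real c * gD_pullback p $ \<alpha> $ \<beta>"
  proof -
    have "complex_hessian (\<lambda>z. Ln (det (gD z))) (snd_block p) = - (c *\<^sub>R gD (snd_block p))"
      using c snd_in_D[OF p] by (simp add: einstein_on_def ricci_def minus_equation_iff[of "complex_hessian _ _"])
    then show ?thesis
      unfolding complex_hessian_pullback[OF open_D S snd_image smooth_Ln_det_gD] gD_pullback_def
      by (cases \<alpha>; cases \<beta>) (simp_all add: scaleR_conv_of_real[where 'a = complex])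
  qed
  ultimately show ?thesis by (simp add: ricci_def algebra_simps)
qed

lemma gD_ne_0: "z \<in> D \<Longrightarrow> gD z \<noteq> 0"
proof
  assume z: "z \<in> D" and "gD z = 0"
  \<comment> \<open>a zero row, with an arbitrary index, already forces the determinant to vanish\<close>
  then have "det (gD z) = 0" by (intro det_zero_row(2)[where j = undefined]) (simp add: row_def vec_eq_iff)
  moreover obtain \<delta> where "\<delta> > 0" "det (gD z) = of_real \<delta>" using det_gD_pos[OF z] .
  ultimately show False by simp
qed

lemma gD_pullback_ne_0: "p \<in> \<Omega> \<Longrightarrow> \<exists>\<alpha> \<beta>. gD_pullback p $ \<alpha> $ \<beta> \<noteq> 0"
proof (rule ccontr)
  assume p: "p \<in> \<Omega>" and 0: "\<not> (\<exists>\<alpha> \<beta>. gD_pullback p $ \<alpha> $ \<beta> \<noteq> 0)"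
  have "gD (snd_block p) $ a $ b = 0" for a b
    using 0 by (metis gD_pullback_def block_matrix_nth(4))
  then show False using gD_ne_0[OF snd_in_D[OF p]] by (simp add: vec_eq_iff)
qed

lemma scalar_curvature_gOmega:
  assumes c: "einstein_on D gD c" and p: "p \<in> \<Omega>"
  shows "scalar_curvature gOmega p = - of_nat ((CARD('m) + CARD('n) + 1) * (CARD('m) + CARD('n)))
           + of_real ((c + real (CARD('n) + 1)) * real CARD('n)) * (1 - t p)"
proof -
  let ?N = "of_nat (CARD('m) + CARD('n) + 1) :: complex" and ?K = "of_real (c + real (CARD('n) + 1)) :: complex"
  define Y where "Y = block_matrix (\<lambda>_ _. 0) (\<lambda>j b. - (1 - t p) * cnj (p $ Inl j) * ub p b)
      (\<lambda>_ _. 0) (\<lambda>a b::'n. (1 - t p) * kron a b)"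
  have pullback_eq: "gD_pullback p = gOmega p ** Y"
    using hartogs_matrix.G_times_lift_block[OF hartogs_matrix_at[OF p], of "ua p" "ub p" "\<lambda>a b. gD (snd_block p) $ a $ b"]
    unfolding gOmega_eq_G[OF p] gD_pullback_def Y_def by (rule sym)
  have "scalar_curvature gOmega p
      = (\<Sum>\<alpha>\<in>UNIV. \<Sum>\<beta>\<in>UNIV. - ?N * (matrix_inv (gOmega p) $ \<beta> $ \<alpha> * (gOmega p ** mat 1) $ \<alpha> $ \<beta>)
          + ?K * (matrix_inv (gOmega p) $ \<beta> $ \<alpha> * (gOmega p ** Y) $ \<alpha> $ \<beta>))"
    unfolding scalar_curvature_def ricci_gOmega[OF c p] pullback_eq matrix_mul_rid
    by (intro sum.cong refl) (simp only: distrib_left mult_ac mult_minus_left mult_minus_right)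
  also have "\<dots> = - ?N * trace (mat 1 :: complex^('m + 'n)^('m + 'n)) + ?K * trace Y"
    unfolding sum.distrib sum_distrib_left[symmetric] sum_inverse_entries_eq_trace[OF det_gOmega_ne_0[OF p]] ..
  also have "trace Y = of_nat CARD('n) * (1 - t p)"
    by (simp add: trace_def sum_UNIV_sum_type Y_def)
  also have "trace (mat 1 :: complex^('m + 'n)^('m + 'n)) = of_nat (CARD('m) + CARD('n))"
    by (simp add: trace_def mat_def)
  finally show ?thesis by (simp only: of_nat_mult of_real_mult of_real_of_nat_eq mult_minus_left mult.assoc)
qed

text \<open>The scalar curvature is a constant minus a multiple of \<open>t\<close>, and the gradient of \<open>t\<close> is known from
  \<open>euler_times_G\<close>. The index order in the sum is the one in which the inverse matrix cancels a row vector times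
  the metric.\<close>

lemma gradient_scalar_curvature_gOmega:
  assumes c: "einstein_on D gD c" and p: "p \<in> \<Omega>"
  shows "(\<Sum>\<beta>\<in>UNIV. matrix_inv (gOmega p) $ \<beta> $ \<alpha> * dzbar \<beta> (scalar_curvature gOmega) p)
    = - of_real ((c + real (CARD('n) + 1)) * real CARD('n))
        * (case \<alpha> of Inl i \<Rightarrow> (1 - t p)\<^sup>2 * p $ Inl i | Inr a \<Rightarrow> 0)"
proof -
  let ?k = "of_real ((c + real (CARD('n) + 1)) * real CARD('n)) :: complex"
  let ?C = "- of_nat ((CARD('m) + CARD('n) + 1) * (CARD('m) + CARD('n))) :: complex"
  \<comment> \<open>the gradient of \<open>t\<close>\<close>
  define X where "X \<gamma> = (case \<gamma> of Inl i \<Rightarrow> (1 - t p)\<^sup>2 * p $ Inl i | Inr (a::'n) \<Rightarrow> 0)" for \<gamma> :: "'m + 'n"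
  have XG: "(\<Sum>\<gamma>\<in>UNIV. X \<gamma> * gOmega p $ \<gamma> $ \<beta>) = dzbar \<beta> t p" for \<beta>
    using hartogs_matrix.euler_times_G[OF hartogs_matrix_at[OF p], of "ua p" "ub p" "\<lambda>a b. gD (snd_block p) $ a $ b" \<beta>]
    by (simp add: sum_UNIV_sum_type X_def gOmega_eq_G[OF p] d_t[OF p])
  have s_eq: "?C + ?k * (1 - t q) = scalar_curvature gOmega q" if "q \<in> \<Omega>" for q
    using scalar_curvature_gOmega[OF c that] by simp
  have ds: "dzbar \<beta> (scalar_curvature gOmega) p = - ?k * dzbar \<beta> t p" for \<beta>
  proof -
    have d: "(\<lambda>q. ?k * (1 - t q)) differentiable (at p)"
      by (intro differentiable_mult differentiable_const differentiable_rules p)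
    have "dzbar \<beta> (scalar_curvature gOmega) p = dzbar \<beta> (\<lambda>q. ?C + ?k * (1 - t q)) p"
      by (rule dzbar_cong[OF open_Omega p s_eq, symmetric]) (simp_all only: differentiable_add d differentiable_const)
    also have "\<dots> = - ?k * dzbar \<beta> t p"
      by (simp add: dzbar_add d dzbar_const dzbar_mult differentiable_rules p d_one_minus_t)
    finally show ?thesis .
  qed
  have "(\<Sum>\<beta>\<in>UNIV. matrix_inv (gOmega p) $ \<beta> $ \<alpha> * dzbar \<beta> (scalar_curvature gOmega) p)
      = - ?k * (\<Sum>\<beta>\<in>UNIV. \<Sum>\<gamma>\<in>UNIV. X \<gamma> * (gOmega p $ \<gamma> $ \<beta> * matrix_inv (gOmega p) $ \<beta> $ \<alpha>))"
    unfolding ds XG[symmetric] sum_distrib_left sum_distrib_right by (simp add: mult_ac)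
  also have "(\<Sum>\<beta>\<in>UNIV. \<Sum>\<gamma>\<in>UNIV. X \<gamma> * (gOmega p $ \<gamma> $ \<beta> * matrix_inv (gOmega p) $ \<beta> $ \<alpha>))
      = (\<Sum>\<gamma>\<in>UNIV. X \<gamma> * (gOmega p ** matrix_inv (gOmega p)) $ \<gamma> $ \<alpha>)"
    by (subst sum.swap) (simp add: matrix_matrix_mult_def sum_distrib_left)
  also have "\<dots> = X \<alpha>"
    by (simp add: matrix_inv_two_sided[OF det_gOmega_ne_0[OF p]] mat_def)
  finally show ?thesis by (simp only: X_def)
qed

text \<open>The witness that the gradient of the scalar curvature fails to be holomorphic: the derivative vanishes
  only where \<open>z\<^sub>i\<close> does.\<close>

lemma dzbar_vertical_field:
  assumes p: "p \<in> \<Omega>"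
  shows "dzbar (Inl i) (\<lambda>q. (1 - t q)\<^sup>2 * q $ Inl i) p = - 2 * E p * (1 - t p) * (p $ Inl i)\<^sup>2"
proof -
  have "(\<lambda>q. (1 - t q) * (1 - t q)) differentiable (at p)"
    by (intro differentiable_mult differentiable_rules p)
  then show ?thesis
    by (simp add: power2_eq_square dzbar_mult differentiable_rules p dzbar_coord d_one_minus_t d_t)
qed

lemma exists_off_axis_point:
  assumes "z \<in> D"
  obtains p where "p \<in> \<Omega>" "p $ Inl i \<noteq> 0" "snd_block p = z" "fst_block p \<noteq> 0"
proof -
  obtain r where r: "r > 0" "r\<^sup>2 < \<phi> z"
    using pos[OF assms] by (intro that[of "sqrt (\<phi> z / 2)"]) simp_all
  define p :: "complex^('m + 'n)" where
    "p = (\<chi> k. case k of Inl j \<Rightarrow> (if j = i then of_real r else 0) | Inr a \<Rightarrow> z $ a)"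
  have s: "snd_block p = z" by (simp add: p_def snd_block_def vec_eq_iff)
  have f: "fst_block p = axis i (of_real r)" by (auto simp: p_def fst_block_def axis_def vec_eq_iff)
  have "norm (fst_block p) = sqrt (\<Sum>j\<in>UNIV. if j = i then r\<^sup>2 else 0)"
    unfolding norm_vec_def L2_set_def f by (intro arg_cong[where f = sqrt] sum.cong) (auto simp: axis_def)
  then have n: "(norm (fst_block p))\<^sup>2 = r\<^sup>2" by simp
  have "p \<in> \<Omega>" unfolding Omega hartogs_domain_def using assms r by (simp add: s n)
  moreover have "p $ Inl i \<noteq> 0" using r by (simp add: p_def)
  moreover have "fst_block p \<noteq> 0" using r by (simp add: f axis_eq_0_iff)
  ultimately show ?thesis using s that by blast
qed

section \<open>The four conditions in terms of the Einstein constant of the base\<close>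

lemma einstein_gOmega_iff:
  assumes c: "einstein_on D gD c" and "\<Omega> \<noteq> {}"
  shows "einstein_on \<Omega> gOmega (- real (CARD('m) + CARD('n) + 1)) \<longleftrightarrow> c = - real (CARD('n) + 1)"
proof -
  let ?K = "of_real (c + real (CARD('n) + 1)) :: complex"
  have "ricci gOmega p = (- real (CARD('m) + CARD('n) + 1)) *\<^sub>R gOmega p \<longleftrightarrow> ?K = 0" if p: "p \<in> \<Omega>" for p
  proof -
    have "ricci gOmega p = (- real (CARD('m) + CARD('n) + 1)) *\<^sub>R gOmega p \<longleftrightarrow> (\<forall>\<alpha> \<beta>. ?K * gD_pullback p $ \<alpha> $ \<beta> = 0)"
      unfolding vec_eq_iff ricci_gOmega[OF c p] by (simp add: scaleR_conv_of_real[where 'a = complex])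
    also have "\<dots> \<longleftrightarrow> ?K = 0" using gD_pullback_ne_0[OF p] by auto
    finally show ?thesis .
  qed
  then have "einstein_on \<Omega> gOmega (- real (CARD('m) + CARD('n) + 1)) \<longleftrightarrow> ?K = 0"
    using \<open>\<Omega> \<noteq> {}\<close> unfolding einstein_on_def by blast
  then show ?thesis unfolding of_real_eq_0_iff by linarith
qed

lemma einstein_gD_iff:
  assumes c: "einstein_on D gD c" and "D \<noteq> {}"
  shows "einstein_on D gD k \<longleftrightarrow> c = k"
proof
  assume k: "einstein_on D gD k"
  obtain z where z: "z \<in> D" using assms by blast
  have "gD z \<noteq> 0" by (rule gD_ne_0[OF z])
  moreover have "c *\<^sub>R gD z = k *\<^sub>R gD z" using bspec[OF c[unfolded einstein_on_def] z] bspec[OF k[unfolded einstein_on_def] z] by (rule trans[OF sym])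
  ultimately show "c = k" by simp
qed (use c in simp)

lemma extremal_gOmega_iff:
  assumes c: "einstein_on D gD c" and "D \<noteq> {}"
  shows "extremal_on \<Omega> gOmega \<longleftrightarrow> c = - real (CARD('n) + 1)"
proof -
  let ?k = "of_real ((c + real (CARD('n) + 1)) * real CARD('n)) :: complex"
  let ?X = "\<lambda>\<alpha> q. case \<alpha> of Inl i \<Rightarrow> (1 - t q)\<^sup>2 * q $ Inl i | Inr (a::'n) \<Rightarrow> 0"
  have smX: "smooth_on \<Omega> (?X \<alpha>)" for \<alpha> :: "'m + 'n"
    by (cases \<alpha>) (simp_all add: smooth_on_const smooth_on_mult open_Omega smooth_one_minus_t smooth_coord power2_eq_square)
  have grad: "dzbar \<eta> (\<lambda>q. \<Sum>\<beta>\<in>UNIV. matrix_inv (gOmega q) $ \<beta> $ \<alpha> * dzbar \<beta> (scalar_curvature gOmega) q) p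
      = - ?k * dzbar \<eta> (?X \<alpha>) p" if p: "p \<in> \<Omega>" for p \<alpha> \<eta>
  proof -
    have d: "?X \<alpha> differentiable (at p)" by (rule smooth_on_differentiable[OF smX p])
    have "dzbar \<eta> (\<lambda>q. - ?k * ?X \<alpha> q) p
        = dzbar \<eta> (\<lambda>q. \<Sum>\<beta>\<in>UNIV. matrix_inv (gOmega q) $ \<beta> $ \<alpha> * dzbar \<beta> (scalar_curvature gOmega) q) p"
      by (rule dzbar_cong[OF open_Omega p gradient_scalar_curvature_gOmega[OF c, symmetric]])
         (simp_all only: differentiable_mult differentiable_const d)
    then show ?thesis by (simp only: dzbar_mult[OF differentiable_const d] dzbar_const mult_zero_left add_0_right)
  qed
  show ?thesis
  proof
    assume ext: "extremal_on \<Omega> gOmega"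
    obtain z where z: "z \<in> D" using assms by blast
    \<comment> \<open>\<open>undefined\<close> stands for an arbitrary index of the first block\<close>
    obtain p where p: "p \<in> \<Omega>" "p $ Inl undefined \<noteq> 0" using exists_off_axis_point[OF z] .
    have "?k * (- 2 * E p * (1 - t p) * (p $ Inl undefined)\<^sup>2) = 0"
      using ext p(1) grad[OF p(1), of "Inl undefined" "Inl undefined"]
      unfolding extremal_on_def by (simp add: dzbar_vertical_field[OF p(1)])
    then have "?k = 0" using p one_minus_t_ne_0[OF p(1)] by (simp add: E_def)
    then show "c = - real (CARD('n) + 1)" unfolding of_real_eq_0_iff by auto
  next
    assume "c = - real (CARD('n) + 1)"
    then have "?k = 0" by simp
    then show "extremal_on \<Omega> gOmega" unfolding extremal_on_def by (simp add: grad)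
  qed
qed

text \<open>If \<open>K \<noteq> 0\<close>, the scalar curvature separates the zero section, where \<open>t = 0\<close>, from every other point of
  the same fibre.\<close>

lemma constant_scalar_curvature_gOmega_iff:
  assumes c: "einstein_on D gD c" and "D \<noteq> {}"
  shows "scalar_curvature gOmega constant_on \<Omega> \<longleftrightarrow> c = - real (CARD('n) + 1)"
proof
  assume "scalar_curvature gOmega constant_on \<Omega>"
  then obtain C where C: "\<And>p. p \<in> \<Omega> \<Longrightarrow> scalar_curvature gOmega p = C" unfolding constant_on_def by blast
  obtain z where z: "z \<in> D" using assms by blast
  obtain p where p: "p \<in> \<Omega>" "snd_block p = z" "fst_block p \<noteq> 0" using exists_off_axis_point[OF z] .
  \<comment> \<open>the point of the zero section in the same fibre as \<open>p\<close>\<close>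
  define q :: "complex^('m + 'n)" where "q = (\<chi> k. case k of Inl j \<Rightarrow> 0 | Inr a \<Rightarrow> z $ a)"
  have sq: "snd_block q = z" and fq: "fst_block q = 0"
    by (simp_all add: q_def snd_block_def fst_block_def vec_eq_iff)
  have q: "q \<in> \<Omega>" using z pos by (simp add: Omega hartogs_domain_def sq fq)
  have "t q = 0" using z by (simp add: t_of_real sq fq)
  moreover have "t p \<noteq> 0" using z p pos[OF z] by (simp add: t_of_real)
  moreover have "of_real ((c + real (CARD('n) + 1)) * real CARD('n)) * (1 - t p)
      = of_real ((c + real (CARD('n) + 1)) * real CARD('n)) * (1 - t q)"
    using C[OF p(1)] C[OF q] unfolding scalar_curvature_gOmega[OF c p(1)] scalar_curvature_gOmega[OF c q]
    by (metis add_left_cancel)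
  ultimately have "complex_of_real ((c + real (CARD('n) + 1)) * real CARD('n)) = 0" 
    by (simp only: mult_left_cancel mult_cancel_left) simp
  then show "c = - real (CARD('n) + 1)" unfolding of_real_eq_0_iff by auto
next
  assume "c = - real (CARD('n) + 1)"
  then have "scalar_curvature gOmega p = - of_nat ((CARD('m) + CARD('n) + 1) * (CARD('m) + CARD('n)))"
    if "p \<in> \<Omega>" for p using scalar_curvature_gOmega[OF c that] by simp
  then show "scalar_curvature gOmega constant_on \<Omega>" unfolding constant_on_def by blast
qed

end

theorem theorem1p1:
  fixes D :: "(complex^'d::finite) set"
    and \<phi> :: "complex^'d \<Rightarrow> real"
    and \<Omega> :: "(complex^('d0::finite + 'd)) set"
    and gD :: "complex^'d \<Rightarrow> complex^'d^'d"
    and g\<Omega> :: "complex^('d0 + 'd) \<Rightarrow> complex^('d0 + 'd)^('d0 + 'd)"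
  assumes "open D" and "connected D" and "D \<noteq> {}"
    and "\<forall>z\<in>D. 0 < \<phi> z"
    and "smooth_on D (\<lambda>z. - ln (\<phi> z))"
    and "strictly_psh_on D (\<lambda>z. - ln (\<phi> z))"
    and "exhaustion_on D (\<lambda>z. - ln (\<phi> z))"
    and "\<Omega> = hartogs_domain D \<phi>"
    and "open \<Omega>" and "connected \<Omega>" and "\<Omega> \<noteq> {}"
    and "bounded \<Omega>" and "pseudoconvex \<Omega>"
    and "gD = kahler_metric (\<lambda>z. - ln (\<phi> z))"
    and "g\<Omega> = kahler_metric (\<lambda>p. - ln (\<phi> (snd_block p) - (norm (fst_block p))\<^sup>2))"
    and "\<exists>c. einstein_on D gD c"
  shows "(einstein_on \<Omega> g\<Omega> (- real (CARD('d0) + CARD('d) + 1)) \<longleftrightarrow> extremal_on \<Omega> g\<Omega>) \<and>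
         (extremal_on \<Omega> g\<Omega> \<longleftrightarrow> scalar_curvature g\<Omega> constant_on \<Omega>) \<and>
         (scalar_curvature g\<Omega> constant_on \<Omega> \<longleftrightarrow> einstein_on D gD (- real (CARD('d) + 1)))"
proof -
  interpret hartogs D \<phi> \<Omega> by standard (use assms in auto)
  have gD: "gD = hartogs.gD \<phi>" and gOmega: "g\<Omega> = hartogs.gOmega \<phi>"
    using assms(14,15) by (simp_all add: gD_def gOmega_def)
  obtain c where c: "einstein_on D (hartogs.gD \<phi>) c" using assms(16) gD by blast
  show ?thesis
    unfolding gD gOmega einstein_gOmega_iff[OF c assms(11)] extremal_gOmega_iff[OF c assms(3)]
      constant_scalar_curvature_gOmega_iff[OF c assms(3)] einstein_gD_iff[OF c assms(3)]
    by blast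
qed

end
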